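(* Let $m$ be a string transduction and $k\ge1$. If $m\in\mathcal{NGSM}^k$ and $m$ is finitary, then $m\in\mathcal{MREL}\circ\mathcal{DGSM}$.
   Context: A 2gsm is $M=(Q,\Sigma_1,\Sigma_2,\delta,q_{in},q_f)$ with finite state set $Q$ and instructions $(p,\sigma,q_1,\alpha_1,\epsilon_1,q_0,\alpha_0,\epsilon_0)$, $p\neq q_f$, $\sigma\in\Sigma_1\cup\{\vdash,\dashv\}$, $\alpha_i\in\Sigma_2^*$, $\epsilon_i\in\{-1,0,+1\}$. On input $w$ the read-only tape is $\vdash w\dashv$ (positions $0..|w|+1$); start in $q_{in}$ at position 0; in state $p$ any instruction starting with $p$ may be executed: if the scanned symbol is $\sigma$, go to $q_1$, append $\alpha_1$ to the one-way output tape and move by $\epsilon_1$, else do the same with $(q_0,\alpha_0,\epsilon_0)$; the head may not leave the tape. $M$ realizes the relation of all $(w,z)$ such that some computation reaches $q_f$ having written $z$. $M$ is deterministic if each state has at most one instruction. $\mathcal{NGSM}$ / $\mathcal{DGSM}$: transductions realized by 2gsm's / deterministic 2gsm's; $\mathcal{NGSM}^k$ is the family of compositions of $k$ transductions from $\mathcal{NGSM}$. A string relabelling given by $R\subseteq\Delta_1\times\Delta_2$ maps $\sigma_1\cdots\sigma_n$ to all $\tau_1\cdots\tau_n$ with $\tau_i\in R(\sigma_i)$. A marked string relabelling maps $w$ to $\vdash w\dashv$ and then applies a string relabelling; $\mathcal{MREL}$ is their family. A relation $m$ is finitary if $\{z\mid(w,z)\in m\}$ is finite for each $w$ in its domain.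 Composition: $R_1\circ R_2=\{(a,c)\mid\exists b:(a,b)\in R_1,(b,c)\in R_2\}$, extended to families elementwise. *)

theory Defs
  imports Main
begin

text \<open>Symbols of all alphabets are natural numbers; an alphabet is a finite set of nats.
  Strings are nat lists; a (string) transduction is a relation on nat lists.\<close>

type_synonym trans = "(nat list \<times> nat list) set"

datatype tsym = LEnd | REnd | Sym nat

definition tape :: "nat list \<Rightarrow> tsym list" where
  "tape w = LEnd # map Sym w @ [REnd]"

text \<open>Instruction (p, sigma, q1, alpha1, eps1, q0, alpha0, eps0).\<close>
type_synonym instr = "nat \<times> tsym \<times> nat \<times> nat list \<times> int \<times> nat \<times> nat list \<times> int"

record gsm =
  states :: "nat set"
  inalph :: "nat set"
  outalph :: "nat set"
  instrs :: "instr set"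
  init :: nat
  final :: nat

definition sym_ok :: "nat set \<Rightarrow> tsym \<Rightarrow> bool" where
  "sym_ok S s = (s = LEnd \<or> s = REnd \<or> (\<exists>a\<in>S. s = Sym a))"

definition wf_gsm :: "gsm \<Rightarrow> bool" where
  "wf_gsm M \<longleftrightarrow>
     finite (states M) \<and> finite (inalph M) \<and> finite (outalph M) \<and> finite (instrs M) \<and>
     init M \<in> states M \<and> final M \<in> states M \<and>
     (\<forall>(p, \<sigma>, q1, \<alpha>1, e1, q0, \<alpha>0, e0) \<in> instrs M.
        p \<in> states M \<and> p \<noteq> final M \<and> sym_ok (inalph M) \<sigma> \<and>
        q1 \<in> states M \<and> set \<alpha>1 \<subseteq> outalph M \<and> e1 \<in> {-1, 0, 1} \<and>
        q0 \<in> states M \<and> set \<alpha>0 \<subseteq> outalph M \<and> e0 \<in> {-1, 0, 1})"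

definition det_gsm :: "gsm \<Rightarrow> bool" where
  "det_gsm M \<longleftrightarrow> (\<forall>i\<in>instrs M. \<forall>j\<in>instrs M. fst i = fst j \<longrightarrow> i = j)"

definition gsm_step :: "gsm \<Rightarrow> nat list \<Rightarrow> (nat \<times> int \<times> nat list) \<Rightarrow> (nat \<times> int \<times> nat list) \<Rightarrow> bool" where
  "gsm_step M w c c' \<longleftrightarrow>
     (\<exists>p i z \<sigma> q1 \<alpha>1 e1 q0 \<alpha>0 e0.
        c = (p, i, z) \<and> (p, \<sigma>, q1, \<alpha>1, e1, q0, \<alpha>0, e0) \<in> instrs M \<and>
        0 \<le> i \<and> i \<le> int (length w) + 1 \<and>
        (let (q, \<alpha>, e) = (if tape w ! nat i = \<sigma> then (q1, \<alpha>1, e1) else (q0, \<alpha>0, e0))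
         in 0 \<le> i + e \<and> i + e \<le> int (length w) + 1 \<and> c' = (q, i + e, z @ \<alpha>)))"

definition realizes :: "gsm \<Rightarrow> trans" where
  "realizes M = {(w, z). set w \<subseteq> inalph M \<and>
      (\<exists>i. (gsm_step M w)\<^sup>*\<^sup>* (init M, 0, []) (final M, i, z))}"

definition NGSM :: "trans set" where
  "NGSM = {m. \<exists>M. wf_gsm M \<and> m = realizes M}"

definition DGSM :: "trans set" where
  "DGSM = {m. \<exists>M. wf_gsm M \<and> det_gsm M \<and> m = realizes M}"

definition marked_relabel :: "(tsym \<times> nat) set \<Rightarrow> trans" where
  "marked_relabel R = {(w, z). length z = length (tape w) \<and>
      (\<forall>i < length z. (tape w ! i, z ! i) \<in> R)}"

definition MREL :: "trans set" where
  "MREL = {m. \<exists>R. finite R \<and> m = marked_relabel R}"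

definition fam_comp :: "trans set \<Rightarrow> trans set \<Rightarrow> trans set" (infixl "\<circ>\<^sub>F" 55) where
  "F \<circ>\<^sub>F G = {m1 O m2 | m1 m2. m1 \<in> F \<and> m2 \<in> G}"

fun fam_pow :: "trans set \<Rightarrow> nat \<Rightarrow> trans set" where
  "fam_pow F 0 = {Id}"
| "fam_pow F (Suc k) = F \<circ>\<^sub>F fam_pow F k"

definition finitary :: "trans \<Rightarrow> bool" where
  "finitary m \<longleftrightarrow> (\<forall>w \<in> Domain m. finite {z. (w, z) \<in> m})"

end

theory Submission
  imports Defs "HOL-Library.Countable" "HOL-Library.Ramsey"
begin

text \<open>
  By induction on the number of factors one proves the more general statement that every
  composition of 2gsm transductions contains a transduction of MREL \<open>\<circ>\<close> DGSM that agrees with it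
  on every input with finitely many images. This reduces the theorem to a nondeterministic writer followed by one
  deterministic two-way reader. Consider a shortest run of the writer for a given final output. If it
  visits one of its configurations very often, then by Ramsey's theorem there are three consecutive
  loops \<open>v1\<close>, \<open>v2\<close>, \<open>v3\<close> at that configuration on which the reader has the same idempotent crossing
  behaviour (which also records whether output is produced). Then either \<open>v2\<close> can be deleted
  without changing the output, contradicting minimality, or repeating \<open>v2\<close> yields arbitrarily long
  outputs, contradicting finiteness. So every configuration is visited boundedly often, a
  relabelling can guess for every cell all the steps of the writer in that cell, together with their
  predecessors and successors, and a deterministic machine can walk forwards and backwards along the
  guessed run and simulate the reader on it.
\<close>

section \<open>Runs of two-way machines and factorizations of the tape\<close>

text \<open>The word passed from the writer to the reader is never stored. A two-way reader may
  return to any place of it, so the writer's run must be retraced backwards, and a nondeterministic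
  run can be retraced only if it has been recorded. A finite relabelling offers only boundedly much
  information per cell, which is why bounded visits are essential. The induction cannot carry
  finitarity: if \<open>realizes G O m\<close> is finitary, \<open>m\<close> is only known to have
  finitely many images at words that \<open>G\<close> outputs. Hence the claim is made for each
  input separately, as containment everywhere and agreement where the image is finite. Three equal
  loops, rather than one, are needed because the reader can turn around inside the pumped part. The
  outer loops are buffers of the same behaviour, so that every border between copies looks alike
  from both sides. Minimality is taken over all intermediate words that lead to the given final
  output, since deleting a loop changes the intermediate word.\<close>

type_synonym ('a, 'q, 'o) twoway = "'a \<Rightarrow> 'q \<Rightarrow> 'q \<times> 'o list \<times> int \<Rightarrow> bool"

text \<open>There are no end markers: a run stops when the head leaves the word, and positions
  outside are admissible as start and end. So a run on a factor makes sense in every context. The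
  step count serves minimal runs and inductions over block decompositions.\<close>

inductive nrun :: "('a, 'q, 'o) twoway \<Rightarrow> 'a list \<Rightarrow> nat \<Rightarrow> int \<times> 'q \<Rightarrow> 'o list \<Rightarrow> int \<times> 'q \<Rightarrow> bool"
  for D v where
  nrun_refl: "nrun D v 0 c [] c"
| nrun_step: "\<lbrakk>0 \<le> i; i < int (length v); D (v ! nat i) q (q', o1, e); nrun D v n (i + e, q') o2 c'\<rbrakk>
    \<Longrightarrow> nrun D v (Suc n) (i, q) (o1 @ o2) c'"

definition run :: "('a, 'q, 'o) twoway \<Rightarrow> 'a list \<Rightarrow> int \<times> 'q \<Rightarrow> 'o list \<Rightarrow> int \<times> 'q \<Rightarrow> bool" where
  "run D v c os c' \<longleftrightarrow> (\<exists>n. nrun D v n c os c')"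

definition deterministic :: "('a, 'q, 'o) twoway \<Rightarrow> bool" where
  "deterministic D \<longleftrightarrow> (\<forall>a q x y. D a q x \<longrightarrow> D a q y \<longrightarrow> x = y)"

definition unit_moves :: "('a, 'q, 'o) twoway \<Rightarrow> bool" where
  "unit_moves D \<longleftrightarrow> (\<forall>a q q' os e. D a q (q', os, e) \<longrightarrow> e \<in> {-1, 0, 1})"

lemma deterministicD: "deterministic D \<Longrightarrow> D a q x \<Longrightarrow> D a q y \<Longrightarrow> x = y"
  unfolding deterministic_def by blast

lemma run_refl [simp]: "run D v c [] c"
  unfolding run_def by (blast intro: nrun_refl)

lemma run_step: "\<lbrakk>0 \<le> i; i < int (length v); D (v ! nat i) q (q', o1, e); run D v (i + e, q') o2 c'\<rbrakk>
    \<Longrightarrow> run D v (i, q) (o1 @ o2) c'"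
  unfolding run_def by (blast intro: nrun_step)

lemma run_step1: "\<lbrakk>0 \<le> i; i < int (length v); D (v ! nat i) q (q', os, e)\<rbrakk>
    \<Longrightarrow> run D v (i, q) os (i + e, q')"
  using run_step[of i v D q q' os e "[]"] by simp

lemma run_induct [consumes 1, case_names refl step]:
  assumes "run D v c os c'"
    and "\<And>c. P c [] c"
    and "\<And>i q q' o1 e o2 c'. \<lbrakk>0 \<le> i; i < int (length v); D (v ! nat i) q (q', o1, e);
        run D v (i + e, q') o2 c'; P (i + e, q') o2 c'\<rbrakk> \<Longrightarrow> P (i, q) (o1 @ o2) c'"
  shows "P c os c'"
proof -
  obtain n where "nrun D v n c os c'" using assms(1) unfolding run_def by blast
  then show ?thesis
  proof induction
    case (nrun_step i q q' o1 e n o2 c')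
    then show ?case using assms(3) unfolding run_def by blast
  qed (rule assms(2))
qed

lemma run_trans: "run D v c o1 c1 \<Longrightarrow> run D v c1 o2 c2 \<Longrightarrow> run D v c (o1 @ o2) c2"
  by (induction rule: run_induct) (auto intro: run_step)

lemma nrun_snoc:
  assumes "nrun D v n c o1 (i, q)" "0 \<le> i" "i < int (length v)" "D (v ! nat i) q (q', o2, e)"
  shows "nrun D v (Suc n) c (o1 @ o2) (i + e, q')"
  using assms
proof (induction n c o1 "(i, q)" rule: nrun.induct)
  case nrun_refl
  then show ?case using nrun_step[of i v D q q' o2 e 0 "[]" "(i + e, q')"] by (simp add: nrun.nrun_refl)
next
  case (nrun_step i' q1 q1' o1' e' n o2')
  then show ?case using nrun.nrun_step[of i' v D q1 q1' o1' e' "Suc n" "o2' @ o2" "(i + e, q')"] by simp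
qed

text \<open>Meant for invariants of everything reachable from a fixed start. Forward induction
  suffices once the part already travelled is accumulated in \<open>oa\<close>.\<close>

lemma run_rev_induct [consumes 1, case_names refl step]:
  assumes "run D v c os c'"
    and refl: "P [] c"
    and step: "\<And>i q q' o1 e o2. \<lbrakk>run D v c o1 (i, q); P o1 (i, q); 0 \<le> i; i < int (length v);
        D (v ! nat i) q (q', o2, e)\<rbrakk> \<Longrightarrow> P (o1 @ o2) (i + e, q')"
  shows "P os c'"
proof -
  have "P (oa @ os) c'" if "run D v c oa d" "P oa d" "run D v d os c'" for oa d
    using that(3,1,2)
  proof (induction arbitrary: oa rule: run_induct)
    case (step i q q' o1 e o2 c')
    have "run D v c (oa @ o1) (i + e, q')"
      using run_trans[OF step.prems(1) run_step1[of i v D q q' o1 e]] step.hyps by blast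
    moreover have "P (oa @ o1) (i + e, q')"
      using assms(3)[OF step.prems step.hyps(1-3)] .
    ultimately show ?case using step.IH by fastforce
  qed simp
  from this[of "[]" c] assms(1) refl show ?thesis by simp
qed

lemma nrun_outside:
  assumes "nrun D v n (i, q) os c'" "\<not> (0 \<le> i \<and> i < int (length v))"
  shows "n = 0 \<and> os = [] \<and> c' = (i, q)"
  using assms by (cases rule: nrun.cases) auto

lemma run_outside:
  assumes "run D v (i, q) os c'" "\<not> (0 \<le> i \<and> i < int (length v))"
  shows "os = [] \<and> c' = (i, q)"
proof -
  obtain n where "nrun D v n (i, q) os c'" using assms(1) unfolding run_def by blast
  from nrun_outside[OF this assms(2)] show ?thesis by simp
qed

lemma run_cases_inside:
  assumes "run D v (i, q) os (j, q')" "(i, q) \<noteq> (j, q')"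
  obtains q1 o1 e o2 where "0 \<le> i" "i < int (length v)" "D (v ! nat i) q (q1, o1, e)"
    "run D v (i + e, q1) o2 (j, q')" "os = o1 @ o2"
proof -
  obtain n where "nrun D v n (i, q) os (j, q')" using assms(1) unfolding run_def by blast
  then show ?thesis
  proof cases
    case (nrun_step q1 o1 e n' o2)
    then show ?thesis using that unfolding run_def by blast
  qed (use assms(2) in simp)
qed

lemma nrun_infix:
  assumes "nrun D v n (i, q) os (j, q')"
  shows "nrun D (u @ v @ x) n (int (length u) + i, q) os (int (length u) + j, q')"
  using assms
proof (induction n "(i, q)" os "(j, q')" arbitrary: i q rule: nrun.induct)
  case nrun_refl
  then show ?case by (simp add: nrun.nrun_refl)
next
  case (nrun_step i q q1 o1 e n o2)
  have "(u @ v @ x) ! nat (int (length u) + i) = v ! nat i"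
    using nrun_step.hyps by (auto simp: nth_append nat_add_distrib)
  then show ?case
    using nrun.nrun_step[of "int (length u) + i" "u @ v @ x" D q q1 o1 e n o2] nrun_step
    by (simp add: add.assoc)
qed

lemma run_infix:
  assumes "run D v (i, q) os (j, q')"
  shows "run D (u @ v @ x) (int (length u) + i, q) os (int (length u) + j, q')"
proof -
  obtain n where "nrun D v n (i, q) os (j, q')" using assms unfolding run_def by blast
  from nrun_infix[OF this] show ?thesis unfolding run_def by blast
qed

lemma run_prefix: "run D v (i, q) os (j, q') \<Longrightarrow> run D (v @ x) (i, q) os (j, q')"
  using run_infix[of D v i q os j q' "[]"] by simp

text \<open>No step starts outside the word, so a run that ends there is maximal, and by determinism
  every run with the same start is a prefix of it.\<close>

lemma run_det:
  assumes "run D v c o1 (j, q)" "\<not> (0 \<le> j \<and> j < int (length v))" "run D v c o2 c2" "deterministic D"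
  shows "\<exists>o3. o1 = o2 @ o3 \<and> run D v c2 o3 (j, q)"
  using assms(3,1,2)
proof (induction arbitrary: o1 rule: run_induct)
  case (step i q' q'' oa e ob c')
  have "(i, q') \<noteq> (j, q)" using step by auto
  then obtain q1 o1' e1 o2' where 1: "D (v ! nat i) q' (q1, o1', e1)"
    "run D v (i + e1, q1) o2' (j, q)" "o1 = o1' @ o2'"
    using run_cases_inside[OF step.prems(1)] by metis
  then have "q1 = q''" "o1' = oa" "e1 = e"
    using deterministicD[OF assms(4) 1(1) step.hyps(3)] by auto
  then show ?case using step.IH[of o2'] 1 step.prems by auto
qed auto

lemma run_det_exit:
  assumes "run D v c o1 (j, q)" "\<not> (0 \<le> j \<and> j < int (length v))"
    "run D v c o2 (j', q')" "\<not> (0 \<le> j' \<and> j' < int (length v))" "deterministic D"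
  shows "o1 = o2" "j = j'" "q = q'"
proof -
  obtain o3 where 1: "o1 = o2 @ o3" "run D v (j', q') o3 (j, q)"
    using run_det[OF assms(1,2,3,5)] by blast
  then have "o3 = []" "(j, q) = (j', q')"
    using run_outside[OF 1(2) assms(4)] by auto
  with 1 show "o1 = o2" "j = j'" "q = q'" by auto
qed

text \<open>
  The flag \<open>s\<close> is true for motion to the right: a block is then entered at its first and left
  beyond its last letter. On an empty block \<open>ent s\<close> and \<open>exi s\<close> coincide, so it is passed in the
  direction of entry.
\<close>

definition ent :: "bool \<Rightarrow> 'a list \<Rightarrow> int" where
  "ent s v = (if s then 0 else int (length v) - 1)"

definition exi :: "bool \<Rightarrow> 'a list \<Rightarrow> int" where
  "exi s v = (if s then int (length v) else -1)"

definition dir :: "bool \<Rightarrow> int" where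
  "dir s = (if s then 1 else -1)"

text \<open>\<open>blk D\<close> is again a two-way machine, which reads a whole block as one letter
  and keeps the direction of motion in its state. Hence all facts about runs apply to it as
  well.\<close>

definition blk :: "('a, 'q, 'o) twoway \<Rightarrow> ('a list, bool \<times> 'q, 'o) twoway" where
  "blk D v p r \<longleftrightarrow> (case (p, r) of ((s, q), ((s', q'), os, e)) \<Rightarrow>
     run D v (ent s v, q) os (exi s' v, q') \<and> e = dir s')"

lemma blk_iff: "blk D v (s, q) ((s', q'), os, e) \<longleftrightarrow>
    run D v (ent s v, q) os (exi s' v, q') \<and> e = dir s'"
  by (simp add: blk_def)

lemma exi_outside: "\<not> (0 \<le> exi s v \<and> exi s v < int (length v))"
  by (simp add: exi_def)

lemma exi_inj: "exi s v = exi s' v \<Longrightarrow> s = s'"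
  by (auto simp: exi_def split: if_splits)

lemma deterministic_blk: "deterministic D \<Longrightarrow> deterministic (blk D)"
  unfolding deterministic_def[of "blk D"]
proof (intro allI impI)
  fix v p x y assume d: "deterministic D" and xy: "blk D v p x" "blk D v p y"
  obtain s q where p: "p = (s, q)" by (cases p)
  obtain s1 q1 o1 e1 where x: "x = ((s1, q1), o1, e1)" by (metis surj_pair)
  obtain s2 q2 o2 e2 where y: "y = ((s2, q2), o2, e2)" by (metis surj_pair)
  show "x = y"
    using xy run_det_exit[of D v "(ent s v, q)" o1 "exi s1 v" q1 o2 "exi s2 v" q2] d
      exi_inj[of s1 v s2] exi_outside[of s1 v] exi_outside[of s2 v]
    by (auto simp: p x y blk_iff)
qed

section \<open>Runs over a concatenation of blocks\<close>

text \<open>Unit moves cannot jump over the two positions bordering the block \<open>v\<close>, so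
  the run splits at its first arrival at one of them. Starting on the border is allowed, as the
  induction gets there. The strict decrease of \<open>n'\<close> after a start inside is the
  termination argument of the block decomposition.\<close>

lemma first_exit:
  assumes "nrun D (u @ v @ x) n (k, q) os (j, q')" "unit_moves D"
    "int (length u) - 1 \<le> k" "k \<le> int (length u) + int (length v)"
    "\<not> (int (length u) \<le> j \<and> j < int (length u) + int (length v))"
  shows "\<exists>s q1 o1 o2 n'. run D v (k - int (length u), q) o1 (exi s v, q1) \<and>
     nrun D (u @ v @ x) n' (int (length u) + exi s v, q1) o2 (j, q') \<and> os = o1 @ o2 \<and> n' \<le> n \<and>
     (int (length u) \<le> k \<and> k < int (length u) + int (length v) \<longrightarrow> n' < n)"
  using assms(1,3-5)
proof (induction n "(k, q)" os "(j, q')" arbitrary: k q rule: nrun.induct)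
  case nrun_refl
  then have "j - int (length u) = -1 \<or> j - int (length u) = int (length v)" by linarith
  then obtain s where s: "j - int (length u) = exi s v" unfolding exi_def by (metis (full_types))
  then have j: "j = int (length u) + exi s v" by simp
  show ?case using nrun_refl nrun.nrun_refl[of D "u @ v @ x"] unfolding j
    by (intro exI[of _ s] exI[of _ q'] exI[of _ "[]"] exI[of _ 0]) simp
next
  case (nrun_step k q q1 o1 e n o2)
  show ?case
  proof (cases "int (length u) \<le> k \<and> k < int (length u) + int (length v)")
    case True
    have nth: "(u @ v @ x) ! nat k = v ! nat (k - int (length u))"
      using True by (auto simp: nth_append nat_diff_distrib)
    have "e \<in> {-1, 0, 1}" using nrun_step.hyps(3) assms(2) unfolding unit_moves_def by blast
    then have "int (length u) - 1 \<le> k + e" "k + e \<le> int (length u) + int (length v)"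
      using True by auto
    from nrun_step.hyps(5)[OF this nrun_step.prems(3)]
    obtain s q2 oa ob n' where 1: "run D v (k + e - int (length u), q1) oa (exi s v, q2)"
      "nrun D (u @ v @ x) n' (int (length u) + exi s v, q2) ob (j, q')" "o2 = oa @ ob" "n' \<le> n"
      by blast
    have "run D v (k - int (length u), q) (o1 @ oa) (exi s v, q2)"
      using run_step[of "k - int (length u)" v D q q1 o1 e oa] True nrun_step.hyps(3) 1(1) nth
      by (auto simp: algebra_simps)
    then show ?thesis using 1(2,3,4)
      by (intro exI[of _ s] exI[of _ q2] exI[of _ "o1 @ oa"] exI[of _ ob] exI[of _ n']) simp
  next
    case False
    then have "k - int (length u) = -1 \<or> k - int (length u) = int (length v)"
      using nrun_step.prems by linarith
    then obtain s where s: "k - int (length u) = exi s v" unfolding exi_def by (metis (full_types))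
    then have k: "k = int (length u) + exi s v" by simp
    have "nrun D (u @ v @ x) (Suc n) (k, q) (o1 @ o2) (j, q')"
      by (rule nrun.nrun_step[OF nrun_step.hyps(1-4)])
    moreover have "run D v (k - int (length u), q) [] (exi s v, q)" using s by simp
    ultimately show ?thesis using False k
      by (intro exI[of _ s] exI[of _ q] exI[of _ "[]"] exI[of _ "o1 @ o2"] exI[of _ "Suc n"]) simp
  qed
qed

lemma concat_split3:
  assumes "0 \<le> t" "t < int (length bs)"
  shows "concat bs = concat (take (nat t) bs) @ bs ! nat t @ concat (drop (Suc (nat t)) bs)"
proof -
  have "bs = take (nat t) bs @ bs ! nat t # drop (Suc (nat t)) bs"
    using assms by (simp add: id_take_nth_drop[symmetric])
  then have "concat bs = concat (take (nat t) bs @ bs ! nat t # drop (Suc (nat t)) bs)" by simp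
  then show ?thesis by simp
qed

text \<open>The position in the concatenation at which block \<open>t\<close> is entered in
  direction \<open>s\<close>. Because it depends on the direction, leaving a block and entering its
  neighbour give the same position, also across empty blocks.\<close>

definition bpos :: "'a list list \<Rightarrow> int \<Rightarrow> bool \<Rightarrow> int" where
  "bpos bs t s = int (length (concat (take (nat (if s then t else t + 1)) bs))) - (if s then 0 else 1)"

lemma bpos_ent:
  assumes "0 \<le> t" "t < int (length bs)"
  shows "bpos bs t s = int (length (concat (take (nat t) bs))) + ent s (bs ! nat t)"
  using assms by (auto simp: bpos_def ent_def nat_add_distrib take_Suc_conv_app_nth)

lemma bpos_exi:
  assumes "0 \<le> t" "t < int (length bs)"
  shows "bpos bs (t + dir s) s = int (length (concat (take (nat t) bs))) + exi s (bs ! nat t)"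
  using assms by (auto simp: bpos_def exi_def dir_def nat_add_distrib take_Suc_conv_app_nth)

lemma run_blk_concat:
  assumes "run (blk D) bs (t, (s, q)) os (t', (s', q'))"
  shows "run D (concat bs) (bpos bs t s, q) os (bpos bs t' s', q')"
proof -
  have "run D (concat bs) (bpos bs (fst c) (fst (snd c)), snd (snd c)) os
      (bpos bs (fst c') (fst (snd c')), snd (snd c'))" if "run (blk D) bs c os c'" for c os c'
    using that
  proof (induction rule: run_induct)
    case (step t p p' o1 e o2 c')
    obtain s q where p: "p = (s, q)" by (cases p)
    obtain s1 q1 where p': "p' = (s1, q1)" by (cases p')
    have 1: "run D (bs ! nat t) (ent s (bs ! nat t), q) o1 (exi s1 (bs ! nat t), q1)" "e = dir s1"
      using step.hyps(3) p p' by (auto simp: blk_iff)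
    have "run D (concat bs) (bpos bs t s, q) o1 (bpos bs (t + dir s1) s1, q1)"
      using run_infix[OF 1(1), of "concat (take (nat t) bs)" "concat (drop (Suc (nat t)) bs)"]
      by (simp add: bpos_ent bpos_exi step.hyps concat_split3[OF step.hyps(1,2)])
    then show ?case using run_trans step.IH p p' 1(2) by fastforce
  qed simp
  from this[OF assms] show ?thesis by simp
qed

text \<open>An empty block is passed without a step of \<open>D\<close>, so induction on
  \<open>n\<close> alone fails. The measure is lexicographic: the number of steps, then the number
  of blocks ahead in the direction of motion, which is below \<open>length bs + 2\<close> and
  decreases at an empty block since the direction is kept there.\<close>

lemma nrun_concat_blk:
  assumes "unit_moves D" "nrun D (concat bs) n (bpos bs t s, q) os (exi s' (concat bs), q')"
    "-1 \<le> t" "t \<le> int (length bs)" "t = -1 \<longrightarrow> \<not> s" "t = int (length bs) \<longrightarrow> s"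
  shows "run (blk D) bs (t, (s, q)) os (exi s' bs, (s', q'))"
  using assms(2-)
proof (induction "n * (length bs + 2) + nat (if s then int (length bs) - t else t + 1)"
    arbitrary: n t s q os rule: less_induct)
  case less
  have outl: "bpos bs (-1) False = -1" "bpos bs (int (length bs)) True = int (length (concat bs))"
    by (auto simp: bpos_def)
  consider "t = -1" "\<not> s" | "t = int (length bs)" "s" | "0 \<le> t" "t < int (length bs)"
    using less.prems by fastforce
  then show ?case
  proof cases
    case 1
    then have b: "bpos bs t s = -1" using outl by simp
    from nrun_outside[OF less.prems(1)] b have "os = []" "exi s' (concat bs) = -1" "q = q'" by auto
    then show ?thesis using 1 by (auto simp: exi_def split: if_splits)
  next
    case 2
    then have b: "bpos bs t s = int (length (concat bs))" using outl by simp
    from nrun_outside[OF less.prems(1)] b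
    have "os = []" "exi s' (concat bs) = int (length (concat bs))" "q = q'" by auto
    then show ?thesis using 2 by (auto simp: exi_def split: if_splits)
  next
    case 3
    define u v x where "u = concat (take (nat t) bs)" and "v = bs ! nat t"
      and "x = concat (drop (Suc (nat t)) bs)"
    have cc: "concat bs = u @ v @ x" using concat_split3[OF 3] by (simp add: u_def v_def x_def)
    have be: "bpos bs t s = int (length u) + ent s v" using bpos_ent[OF 3] by (simp add: u_def v_def)
    have en: "int (length u) - 1 \<le> bpos bs t s" "bpos bs t s \<le> int (length u) + int (length v)"
      by (auto simp: be ent_def)
    have ex: "\<not> (int (length u) \<le> exi s' (concat bs) \<and> exi s' (concat bs) < int (length u) + int (length v))"
      by (auto simp: exi_def cc)
    from first_exit[OF less.prems(1)[unfolded cc] assms(1) en ex[unfolded cc]]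
    obtain s1 q1 o1 o2 n' where 4: "run D v (ent s v, q) o1 (exi s1 v, q1)"
      "nrun D (concat bs) n' (int (length u) + exi s1 v, q1) o2 (exi s' (concat bs), q')"
      "os = o1 @ o2" "n' \<le> n" "v \<noteq> [] \<longrightarrow> n' < n"
      unfolding cc be by (force simp: ent_def)
    have bx: "int (length u) + exi s1 v = bpos bs (t + dir s1) s1"
      using bpos_exi[OF 3] by (simp add: u_def v_def)
    have "run (blk D) bs (t + dir s1, (s1, q1)) o2 (exi s' bs, (s', q'))"
    proof (rule less.hyps)
      let ?m = "\<lambda>s t. nat (if s then int (length bs) - t else t + 1)"
      have le: "?m s1 (t + dir s1) < length bs + 2" using 3 by (auto simp: dir_def)
      show "n' * (length bs + 2) + ?m s1 (t + dir s1) < n * (length bs + 2) + ?m s t"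
      proof (cases "n' < n")
        case True
        then have "Suc n' * (length bs + 2) \<le> n * (length bs + 2)" by (intro mult_le_mono1) simp
        then show ?thesis using le by simp
      next
        case False
        then have "v = []" "n' = n" using 4 by auto
        then have "ent s v = exi s1 v" using run_outside[OF 4(1)] by auto
        then have "s1 = s" by (auto simp: \<open>v = []\<close> ent_def exi_def split: if_splits)
        then show ?thesis using 3 \<open>n' = n\<close> by (auto simp: dir_def)
      qed
      show "nrun D (concat bs) n' (bpos bs (t + dir s1) s1, q1) o2 (exi s' (concat bs), q')"
        using 4(2) unfolding bx .
      show "- 1 \<le> t + dir s1" "t + dir s1 \<le> int (length bs)"
        "t + dir s1 = - 1 \<longrightarrow> \<not> s1" "t + dir s1 = int (length bs) \<longrightarrow> s1"
        using 3 by (simp_all add: dir_def)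
    qed
    moreover have "blk D (bs ! nat t) (s, q) ((s1, q1), o1, dir s1)"
      using 4(1) by (simp add: blk_iff v_def)
    ultimately show ?thesis
      using run_step[of t bs "blk D" "(s, q)" "(s1, q1)" o1 "dir s1" o2] 3 4(3) by simp
  qed
qed

lemma run_concat_blk:
  assumes "unit_moves D" "run D (concat bs) (bpos bs t s, q) os (exi s' (concat bs), q')"
    "-1 \<le> t" "t \<le> int (length bs)" "t = -1 \<longrightarrow> \<not> s" "t = int (length bs) \<longrightarrow> s"
  shows "run (blk D) bs (t, (s, q)) os (exi s' bs, (s', q'))"
proof -
  obtain n where "nrun D (concat bs) n (bpos bs t s, q) os (exi s' (concat bs), q')"
    using assms(2) unfolding run_def by blast
  then show ?thesis using nrun_concat_blk[OF assms(1) _ assms(3-6)] by blast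
qed

lemma bpos_exi_all [simp]: "bpos bs (exi s bs) s = exi s (concat bs)"
  by (auto simp: bpos_def exi_def)

lemma run_concat_blk_iff:
  assumes "unit_moves D" "0 \<le> t" "t < int (length bs)"
  shows "run (blk D) bs (t, (s, q)) os (exi s' bs, (s', q')) \<longleftrightarrow>
    run D (concat bs) (bpos bs t s, q) os (exi s' (concat bs), q')"
  using run_blk_concat[of D bs t s q os "exi s' bs" s' q'] run_concat_blk[OF assms(1)] assms(2,3)
  by auto

section \<open>Pumping idempotent factors\<close>

lemma bpos_ent_all [simp]: "bpos bs (ent s bs) s = ent s (concat bs)"
  by (cases s) (auto simp: bpos_def ent_def)

text \<open>The state type may be infinite; a set \<open>Q\<close> that contains every state entered
  by a step is what makes the number of behaviours finite.\<close>

locale machine =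
  fixes D :: "('a, 'q, 'o) twoway" and Q :: "'q set"
  assumes det: "deterministic D"
    and unit: "unit_moves D"
    and closed: "D a q (q', os, e) \<Longrightarrow> q' \<in> Q"
begin

lemma blk_concat_iff:
  "run (blk D) bs (ent s bs, (s, q)) os (exi s' bs, (s', q')) \<longleftrightarrow>
    run D (concat bs) (ent s (concat bs), q) os (exi s' (concat bs), q')"
proof -
  have "- 1 \<le> ent s bs" "ent s bs \<le> int (length bs)" "ent s bs = - 1 \<longrightarrow> \<not> s"
    "ent s bs = int (length bs) \<longrightarrow> s"
    by (simp_all add: ent_def)
  then show ?thesis
    using run_blk_concat[of D bs "ent s bs" s q os "exi s' bs" s' q']
      run_concat_blk[OF unit, of bs "ent s bs" s q os s' q'] by auto
qed

section \<open>Crossing behaviour as a congruence\<close>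

lemma run_closed: "run D v c os c' \<Longrightarrow> snd c \<in> Q \<Longrightarrow> snd c' \<in> Q"
  by (induction rule: run_induct) (auto intro: closed)

lemma blk_closed: "blk D v (s, q) ((s', q'), os, e) \<Longrightarrow> q \<in> Q \<Longrightarrow> q' \<in> Q"
  using run_closed[of v "(ent s v, q)" os "(exi s' v, q')"] by (simp add: blk_iff)

text \<open>Recording the output itself would give infinitely many behaviours; its emptiness is the
  finite remainder that pumping needs.\<close>

definition behaviour :: "'a list \<Rightarrow> ((bool \<times> 'q) \<times> (bool \<times> 'q) \<times> bool) set" where
  "behaviour v = {((s, q), (s', q'), b). q \<in> Q \<and> (\<exists>os e. blk D v (s, q) ((s', q'), os, e) \<and> b = (os = []))}"

lemma behaviour_subset: "behaviour v \<subseteq> (UNIV \<times> Q) \<times> (UNIV \<times> Q) \<times> UNIV"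
  unfolding behaviour_def using blk_closed by auto

lemma behaviourE:
  assumes "behaviour v = behaviour v'" "q \<in> Q" "blk D v (s, q) ((s', q'), os, e)"
  obtains os' where "blk D v' (s, q) ((s', q'), os', e)" "(os' = []) = (os = [])"
proof -
  have "((s, q), (s', q'), os = []) \<in> behaviour v" using assms unfolding behaviour_def by blast
  then have "((s, q), (s', q'), os = []) \<in> behaviour v'" using assms by simp
  then obtain os' e' where "blk D v' (s, q) ((s', q'), os', e')" "(os' = []) = (os = [])"
    unfolding behaviour_def by auto
  moreover have "e' = e" using calculation assms(3) by (simp add: blk_iff)
  ultimately show ?thesis using that by blast
qed

text \<open>Each crossing of a block can be replaced by a crossing of a block of equal behaviour,
  and a concatenation is empty iff all its parts are.\<close>

lemma run_blk_behaviour: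
  assumes "run (blk D) bs c os c'" "length bs' = length bs"
    "\<And>t. t < length bs \<Longrightarrow> behaviour (bs ! t) = behaviour (bs' ! t)" "snd (snd c) \<in> Q"
  shows "\<exists>os'. run (blk D) bs' c os' c' \<and> (os' = []) = (os = [])"
  using assms(1,4)
proof (induction rule: run_induct)
  case (refl c)
  then show ?case by auto
next
  case (step t p p' o1 e o2 c')
  obtain s q s' q' where p: "p = (s, q)" "p' = (s', q')" by (metis surj_pair)
  have "nat t < length bs" using step by auto
  from behaviourE[OF assms(3)[OF this], of q s s' q' o1 e] step p obtain o1'
    where 1: "blk D (bs' ! nat t) p (p', o1', e)" "(o1' = []) = (o1 = [])" by auto
  have "q' \<in> Q" using blk_closed step.hyps(3) step.prems p by auto
  then obtain o2' where "run (blk D) bs' (t + e, p') o2' c'" "(o2' = []) = (o2 = [])"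
    using step.IH p by auto
  then show ?case
    using run_step[of t bs' "blk D" p p' o1' e o2' c'] 1 step.hyps assms(2)
    by (intro exI[of _ "o1' @ o2'"]) simp
qed

lemma behaviour_concat_subset:
  assumes "length bs' = length bs" "\<And>t. t < length bs \<Longrightarrow> behaviour (bs ! t) = behaviour (bs' ! t)"
  shows "behaviour (concat bs) \<subseteq> behaviour (concat bs')"
proof
  fix x assume x: "x \<in> behaviour (concat bs)"
  obtain s q s' q' b where x': "x = ((s, q), (s', q'), b)" by (metis surj_pair)
  with x obtain os where 1: "q \<in> Q" "run D (concat bs) (ent s (concat bs), q) os (exi s' (concat bs), q')"
    "b = (os = [])"
    unfolding behaviour_def by (auto simp: blk_iff)
  have e: "ent s bs' = ent s bs" "exi s' bs' = exi s' bs" using assms(1) by (simp_all add: ent_def exi_def)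
  from run_blk_behaviour[OF 1(2)[folded blk_concat_iff] assms] 1(1) e
  obtain os' where "run (blk D) bs' (ent s bs', (s, q)) os' (exi s' bs', (s', q'))" "(os' = []) = (os = [])"
    by auto
  then show "x \<in> behaviour (concat bs')" using x' 1 unfolding behaviour_def blk_concat_iff
    by (auto simp: blk_iff)
qed

lemma behaviour_append:
  assumes "behaviour a = behaviour a'" "behaviour b = behaviour b'"
  shows "behaviour (a @ b) = behaviour (a' @ b')"
  using behaviour_concat_subset[of "[a', b']" "[a, b]"] behaviour_concat_subset[of "[a, b]" "[a', b']"] assms
  by (force simp: less_Suc_eq_0_disj)

text \<open>Treats both directions at once: a head moving in direction \<open>s\<close> meets
  \<open>a\<close> before \<open>b\<close>, and \<open>mid s a b\<close> is where it then enters
  \<open>b\<close>.\<close>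

definition cat :: "bool \<Rightarrow> 'a list \<Rightarrow> 'a list \<Rightarrow> 'a list" where
  "cat s a b = (if s then a @ b else b @ a)"

definition mid :: "bool \<Rightarrow> 'a list \<Rightarrow> 'a list \<Rightarrow> int" where
  "mid s a b = (if s then int (length a) else int (length b) - 1)"

lemma run_cat_first:
  assumes "run D a (ent s a, q) os (exi s a, q')"
  shows "run D (cat s a b) (ent s (cat s a b), q) os (mid s a b, q')"
proof (cases s)
  case True
  then show ?thesis using run_prefix[of D a 0 q os "int (length a)" q' b] assms
    by (simp add: ent_def exi_def cat_def mid_def)
next
  case False
  then show ?thesis using run_infix[of D a "int (length a) - 1" q os "-1" q' b "[]"] assms
    by (simp add: ent_def exi_def cat_def mid_def add_diff_eq)
qed

text \<open>A head that leaves \<open>a\<close> on the side of entry has not seen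
  \<open>b\<close>.\<close>

lemma run_cat_return:
  assumes "run D a (ent s a, q) os (exi (\<not> s) a, q')"
  shows "run D (cat s a b) (ent s (cat s a b), q) os (exi (\<not> s) (cat s a b), q')"
proof (cases s)
  case True
  then show ?thesis using run_prefix[of D a 0 q os "-1" q' b] assms
    by (simp add: ent_def exi_def cat_def)
next
  case False
  then show ?thesis using run_infix[of D a "int (length a) - 1" q os "int (length a)" q' b "[]"] assms
    by (simp add: ent_def exi_def cat_def add_diff_eq)
qed

text \<open>From the border the reader may still go back and forth between \<open>a\<close> and
  \<open>b\<close>; this is a run over two blocks started at \<open>b\<close>, so only the two
  behaviours count.\<close>

lemma run_mid_behaviour:
  assumes "run D (cat s a b) (mid s a b, q) os (exi s (cat s a b), q')" "q \<in> Q"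
    "behaviour a = behaviour a'" "behaviour b = behaviour b'"
  shows "\<exists>os'. run D (cat s a' b') (mid s a' b', q) os' (exi s (cat s a' b'), q') \<and> (os' = []) = (os = [])"
proof -
  define bs where "bs = (\<lambda>a b. if s then [a, b] else [b, a :: 'a list])"
  define t :: int where "t = (if s then 1 else 0)"
  have c: "concat (bs a b) = cat s a b" "bpos (bs a b) t s = mid s a b" "0 \<le> t" "t < int (length (bs a b))"
    "exi s (bs a b) = (if s then 2 else -1)" for a b
    by (auto simp: bs_def cat_def t_def bpos_def mid_def exi_def)
  have l: "length (bs a' b') = length (bs a b)" by (simp add: bs_def)
  have ty: "behaviour (bs a b ! i) = behaviour (bs a' b' ! i)" if "i < length (bs a b)" for i
    using that assms(3,4) by (auto simp: bs_def less_Suc_eq_0_disj split: if_splits)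
  have "run (blk D) (bs a b) (t, (s, q)) os (exi s (bs a b), (s, q'))"
    using run_concat_blk_iff[OF unit c(3,4), of a b s q os s q'] assms(1) by (simp add: c(1,2))
  from run_blk_behaviour[OF this l ty] assms(2)
  obtain os' where "run (blk D) (bs a' b') (t, (s, q)) os' (exi s (bs a' b'), (s, q'))" "(os' = []) = (os = [])"
    by (auto simp: c(5))
  then show ?thesis
    using run_concat_blk_iff[OF unit c(3,4), of a' b' s q os' s q'] by (auto simp: c(1,2))
qed

end

section \<open>Varying the number of copies of an idempotent factor\<close>

locale idempotent = machine +
  fixes v1 v2 v3
  assumes idem: "behaviour v1 = behaviour v2" "behaviour v3 = behaviour v2"
    "behaviour (v2 @ v2) = behaviour v2"
begin

abbreviation E :: "'a list \<Rightarrow> bool" where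
  "E v \<equiv> behaviour v = behaviour v2"

lemma E_cat: "E a \<Longrightarrow> E b \<Longrightarrow> E (cat s a b)"
  using behaviour_append[of a v2 b v2] behaviour_append[of b v2 a v2] idem by (simp add: cat_def)

text \<open>\<open>cat s a b\<close> has the behaviour of \<open>a\<close>, so it is crossed from
  \<open>q\<close> into the same state \<open>q'\<close>. By determinism the crossing of
  \<open>a\<close> is a prefix of that run, and the rest starts at the border in
  \<open>q'\<close>.\<close>

lemma run_cat_split:
  assumes "E a" "E b" "q \<in> Q" "run D a (ent s a, q) o1 (exi s a, q')"
  shows "\<exists>o2. run D (cat s a b) (mid s a b, q') o2 (exi s (cat s a b), q')"
proof -
  have "blk D a (s, q) ((s, q'), o1, dir s)" using assms(4) by (simp add: blk_iff)
  moreover have "behaviour a = behaviour (cat s a b)" using E_cat[OF assms(1,2)] assms(1) by simp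
  ultimately obtain os where "run D (cat s a b) (ent s (cat s a b), q) os (exi s (cat s a b), q')"
    using behaviourE[OF _ assms(3)] unfolding blk_iff by metis
  from run_det[OF this exi_outside run_cat_first[OF assms(4)] det] show ?thesis by blast
qed

fun pump :: "bool \<Rightarrow> 'a list \<Rightarrow> nat \<Rightarrow> 'a list" where
  "pump s a 0 = a"
| "pump s a (Suc n) = cat s (pump s a n) v2"

lemma E_pump: "E a \<Longrightarrow> E (pump s a n)"
  by (induction n) (simp_all add: E_cat)

text \<open>
  By idempotence the reader leaves each prefix of copies in the same state \<open>q'\<close>. Between two such
  moments its behaviour is determined by the types on both sides, so either all these
  crossings are silent or all of them produce output.
\<close>

lemma run_pump:
  assumes "E a" "q \<in> Q" "run D a (ent s a, q) o1 (exi s a, q')"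
  shows "(\<forall>n b. E b \<longrightarrow> run D (cat s (pump s a n) b) (ent s (cat s (pump s a n) b), q) o1
            (exi s (cat s (pump s a n) b), q')) \<or>
         (\<forall>n b. E b \<longrightarrow> (\<exists>os. n \<le> length os \<and> run D (cat s (pump s a n) b) (ent s (cat s (pump s a n) b), q) os
            (exi s (cat s (pump s a n) b), q')))"
proof -
  have q': "q' \<in> Q" using run_closed[OF assms(3)] assms(2) by simp
  obtain os0 where 0: "run D (cat s a v2) (mid s a v2, q') os0 (exi s (cat s a v2), q')"
    using run_cat_split[OF assms(1) refl assms(2,3)] by blast
  have seg: "\<exists>os. run D (cat s c b) (mid s c b, q') os (exi s (cat s c b), q') \<and> (os = []) = (os0 = [])"
    if "E c" "E b" for c b
    by (rule run_mid_behaviour[OF 0 q' trans[OF assms(1) that(1)[symmetric]] that(2)[symmetric]])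
  show ?thesis
  proof (cases "os0 = []")
    case True
    have step: "run D (cat s c b) (ent s (cat s c b), q) o1 (exi s (cat s c b), q')"
      if "E c" "E b" "run D c (ent s c, q) o1 (exi s c, q')" for c b
      using run_trans[OF run_cat_first[OF that(3), of b]] seg[OF that(1,2)] True by fastforce
    have "run D (pump s a n) (ent s (pump s a n), q) o1 (exi s (pump s a n), q')" for n
      by (induction n) (use assms(3) step E_pump[OF assms(1)] in auto)
    then show ?thesis using step E_pump[OF assms(1)] by blast
  next
    case False
    have step: "\<exists>os. Suc n \<le> length os \<and> run D (cat s c b) (ent s (cat s c b), q) os (exi s (cat s c b), q')"
      if Ec: "E c" "E b" and r: "\<exists>os. n \<le> length os \<and> run D c (ent s c, q) os (exi s c, q')" for c b n
    proof -
      obtain o2 where 2: "run D c (ent s c, q) o2 (exi s c, q')" "n \<le> length o2" using r by blast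
      obtain o3 where 3: "run D (cat s c b) (mid s c b, q') o3 (exi s (cat s c b), q')" "o3 \<noteq> []"
        using seg[OF Ec] False by blast
      have "run D (cat s c b) (ent s (cat s c b), q) (o2 @ o3) (exi s (cat s c b), q')"
        using run_trans[OF run_cat_first[OF 2(1)] 3(1)] .
      moreover have "Suc n \<le> length (o2 @ o3)" using 2 3 by (cases o3) auto
      ultimately show ?thesis by blast
    qed
    have "\<exists>os. n \<le> length os \<and> run D (pump s a n) (ent s (pump s a n), q) os (exi s (pump s a n), q')" for n
    proof (induction n)
      case (Suc n)
      show ?case using step[OF E_pump[OF assms(1)] refl Suc] by simp
    qed (use assms(3) in auto)
    then show ?thesis using step[OF E_pump[OF assms(1)]] by (meson Suc_leD)
  qed
qed

text \<open>\<open>M 1\<close> is the factor that really occurs, \<open>M 0\<close> has the middle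
  loop deleted. From whichever side the reader comes, a buffer of the common behaviour lies before
  and behind the copies.\<close>

definition M :: "nat \<Rightarrow> 'a list" where
  "M n = v1 @ concat (replicate n v2) @ v3"

lemma pump_True: "pump True a n = a @ concat (replicate n v2)"
proof (induction n)
  case (Suc n)
  have "concat (replicate n v2) @ v2 = concat (replicate n v2 @ [v2])" by simp
  also have "\<dots> = v2 @ concat (replicate n v2)" by (simp only: replicate_append_same) simp
  finally show ?case using Suc by (simp add: cat_def)
qed simp

lemma pump_False: "pump False a n = concat (replicate n v2) @ a"
  by (induction n) (simp_all add: cat_def)

lemma M_pump: "M n = cat s (pump s (if s then v1 else v3) n) (if s then v3 else v1)"
  by (simp add: M_def pump_True pump_False cat_def)

text \<open>A crossing is settled by \<open>run_pump\<close>. A return already happens inside the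
  buffer \<open>a\<close>, because \<open>M 1\<close> and \<open>a\<close> have the same behaviour,
  and so its output is the same for all \<open>n\<close>.\<close>

lemma blk_M:
  assumes "blk D (M 1) (s, q) ((s', q'), os, e)" "q \<in> Q"
  shows "(\<forall>n. blk D (M n) (s, q) ((s', q'), os, e)) \<or>
    (\<forall>n. \<exists>os'. n \<le> length os' \<and> blk D (M n) (s, q) ((s', q'), os', e))"
proof -
  define a b where "a = (if s then v1 else v3)" and "b = (if s then v3 else v1)"
  have M: "M n = cat s (pump s a n) b" for n using M_pump by (simp add: a_def b_def)
  have ab: "E a" "E b" using idem by (auto simp: a_def b_def)
  have "E (M 1)" unfolding M by (rule E_cat[OF E_pump[OF ab(1)] ab(2)])
  then have "behaviour (M 1) = behaviour a" using ab by simp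
  from behaviourE[OF this assms(2,1)] obtain o1 where o1: "blk D a (s, q) ((s', q'), o1, e)" by blast
  \<comment> \<open>In the alternative without growth all words \<open>M n\<close> yield the output
    \<open>o1\<close> of the buffer alone; the case \<open>n = 1\<close> identifies it with
    \<open>os\<close>.\<close>
  have eq: "os = o1" if "blk D (M 1) (s, q) ((s', q'), o1, e)"
    using deterministicD[OF deterministic_blk[OF det] that assms(1)] by simp
  show ?thesis
  proof (cases "s' = s")
    case True
    then show ?thesis
      using run_pump[OF ab(1) assms(2), of s o1 q'] o1 ab(2) eq unfolding M blk_iff by blast
  next
    case False
    then have s': "s' = (\<not> s)" by simp
    have "blk D (pump s a n) (s, q) ((s', q'), o1, e)" for n
      by (induction n) (use o1 in \<open>simp_all add: blk_iff s' run_cat_return\<close>)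
    then have "blk D (M n) (s, q) ((s', q'), o1, e)" for n
      unfolding M by (simp add: blk_iff s' run_cat_return)
    then show ?thesis using eq by blast
  qed
qed

text \<open>The whole run may pass through the pumped part many times. If one passage grows with
  \<open>n\<close>, so does the total, as all other pieces still exist for every \<open>n\<close>
  with some output; otherwise nothing changes.\<close>

lemma run_blk_M:
  assumes "run (blk D) [u, M 1, x] c os c'" "snd (snd c) \<in> Q"
  shows "(\<forall>n. run (blk D) [u, M n, x] c os c') \<or>
    (\<forall>n. \<exists>os'. n \<le> length os' \<and> run (blk D) [u, M n, x] c os' c')"
  using assms
proof (induction rule: run_induct)
  case (step t p p' o1 e o2 c')
  obtain s q s' q' where p: "p = (s, q)" "p' = (s', q')" by (metis surj_pair)
  let ?b = "\<lambda>n. [u, M n, x] ! nat t"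
  have t: "t \<in> {0, 1, 2}" using step.hyps(1,2) by auto
  have 1: "(\<forall>n. blk D (?b n) p (p', o1, e)) \<or>
    (\<forall>n. \<exists>os'. n \<le> length os' \<and> blk D (?b n) p (p', os', e))"
  proof (cases "t = 1")
    case True
    then show ?thesis using blk_M[of s q s' q' o1 e] step.hyps(3) step.prems p by simp
  next
    case False
    then show ?thesis using t step.hyps(3) by auto
  qed
  have "q' \<in> Q" using blk_closed step.hyps(3) step.prems p by auto
  then have 2: "(\<forall>n. run (blk D) [u, M n, x] (t + e, p') o2 c') \<or>
    (\<forall>n. \<exists>os'. n \<le> length os' \<and> run (blk D) [u, M n, x] (t + e, p') os' c')"
    using step.IH p by simp
  have st: "run (blk D) [u, M n, x] (t, p) (oa @ ob) c'"
    if "blk D (?b n) p (p', oa, e)" "run (blk D) [u, M n, x] (t + e, p') ob c'" for n oa ob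
    using run_step[of t "[u, M n, x]" "blk D" p p' oa e ob c'] that step.hyps(1,2) by simp
  have grow: "\<exists>os'. n \<le> length os' \<and> run (blk D) [u, M n, x] (t, p) os' c'"
    if "blk D (?b n) p (p', oa, e)" "run (blk D) [u, M n, x] (t + e, p') ob c'"
      "n \<le> length oa \<or> n \<le> length ob" for n oa ob
    using st[OF that(1,2)] that(3) by (intro exI[of _ "oa @ ob"]) auto
  show ?case
  proof (cases "(\<forall>n. blk D (?b n) p (p', o1, e)) \<and> (\<forall>n. run (blk D) [u, M n, x] (t + e, p') o2 c')")
    case True
    then show ?thesis using st by blast
  next
    case False
    then consider
      "\<forall>n. \<exists>oa. n \<le> length oa \<and> blk D (?b n) p (p', oa, e)" |
      "\<forall>n. \<exists>ob. n \<le> length ob \<and> run (blk D) [u, M n, x] (t + e, p') ob c'"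
      using 1 2 by blast
    then have "\<forall>n. \<exists>os'. n \<le> length os' \<and> run (blk D) [u, M n, x] (t, p) os' c'"
    proof cases
      case A: 1
      have "\<exists>ob. run (blk D) [u, M n, x] (t + e, p') ob c'" for n using 2 by blast
      then show ?thesis using A grow by blast
    next
      case B: 2
      have "\<exists>oa. blk D (?b n) p (p', oa, e)" for n using 1 by blast
      then show ?thesis using B grow by blast
    qed
    then show ?thesis ..
  qed
qed simp

lemma run_M:
  assumes "run D (u @ M 1 @ x) (0, q) os (int (length (u @ M 1 @ x)), q')" "q \<in> Q"
  shows "run D (u @ M 0 @ x) (0, q) os (int (length (u @ M 0 @ x)), q') \<or>
    (\<forall>n. \<exists>os'. n \<le> length os' \<and> run D (u @ M n @ x) (0, q) os' (int (length (u @ M n @ x)), q'))"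
proof -
  have eq: "run D (u @ M n @ x) (0, q) os (int (length (u @ M n @ x)), q') \<longleftrightarrow>
    run (blk D) [u, M n, x] (0, (True, q)) os (3, (True, q'))" for n os
    using blk_concat_iff[of "[u, M n, x]" True q os True q'] by (simp add: ent_def exi_def)
  show ?thesis using run_blk_M[of u x "(0, (True, q))" os "(3, (True, q'))"] assms unfolding eq by auto
qed

end

section \<open>Bounding the number of visits\<close>

lemma ramsey_idempotent:
  assumes "finite (C :: 'c set)"
  shows "\<exists>K::nat. \<forall>S f. K \<le> card (S :: nat set) \<longrightarrow> finite S \<longrightarrow> (\<forall>i j. f i j \<in> C) \<longrightarrow>
    (\<exists>a b c d. {a, b, c, d} \<subseteq> S \<and> a < b \<and> b < c \<and> c < d \<and>
       f a b = f b c \<and> f c d = f b c \<and> f a c = f b c \<and> f b d = f b c)"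
proof -
  define m where "m = card C"
  obtain idx :: "'c \<Rightarrow> nat" where idx: "bij_betw idx C {0..<m}"
    using ex_bij_betw_finite_nat[OF assms] m_def by blast
  \<comment> \<open>Three consecutive factors have four cut points, hence homogeneous sets of size
    4.\<close>
  obtain K :: nat where K: "partn_lst {..<K} (replicate m 4) 2" using ramsey_full by blast
  show ?thesis
  proof (rule exI[of _ K], intro allI impI)
    fix S :: "nat set" and f :: "nat \<Rightarrow> nat \<Rightarrow> 'c"
    assume S: "K \<le> card S" "finite S" and f: "\<forall>i j. f i j \<in> C"
    obtain h where h: "bij_betw h {0..<card S} S" using ex_bij_betw_nat_finite[OF S(2)] by blast
    \<comment> \<open>The enumeration \<open>h\<close> need not be monotone, so the two cut points
      are sorted by \<open>Min\<close> and \<open>Max\<close> before the factor between them is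
      coloured.\<close>
    define F where "F X = idx (f (Min (h ` X)) (Max (h ` X)))" for X
    have "F \<in> nsets {..<K} 2 \<rightarrow> {..<m}"
      using bij_betwE[OF idx] f by (auto simp: F_def)
    from partn_lstE[OF K this] obtain k H where k: "k < m" "H \<in> nsets {..<K} 4" "F ` nsets H 2 \<subseteq> {k}"
      by (metis length_replicate nth_replicate)
    have H: "H \<subseteq> {0..<card S}" "card H = 4" "finite H" using k(2) S(1) by (auto simp: nsets_def)
    then have "card (h ` H) = 4" "h ` H \<subseteq> S"
      using h by (auto simp: bij_betw_def card_image inj_on_subset)
    then have "h ` H \<in> nsets (h ` H) 4" using H by (simp add: nsets_def)
    then obtain a b c d where abcd: "{a, b, c, d} \<subseteq> h ` H" "a < b" "b < c" "c < d"
      unfolding ordered_nsets_4_eq by blast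
    have col: "idx (f x y) = k" if xy: "x \<in> h ` H" "y \<in> h ` H" "x < y" for x y
    proof -
      obtain i j where ij: "i \<in> H" "j \<in> H" "x = h i" "y = h j" using xy by auto
      then have "{i, j} \<in> nsets H 2" using xy(3) by auto
      then have "F {i, j} = k" using k(3) by blast
      then show ?thesis using ij xy(3) by (simp add: F_def min_def max_def)
    qed
    have same: "f x y = f b c" if "x \<in> h ` H" "y \<in> h ` H" "x < y" for x y
    proof -
      have "idx (f x y) = idx (f b c)" using col[OF that] col[of b c] abcd by simp
      then show ?thesis using idx f by (meson bij_betw_def inj_onD)
    qed
    show "\<exists>a b c d. {a, b, c, d} \<subseteq> S \<and> a < b \<and> b < c \<and> c < d \<and>
       f a b = f b c \<and> f c d = f b c \<and> f a c = f b c \<and> f b d = f b c"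
      using abcd \<open>h ` H \<subseteq> S\<close> same[of a b] same[of c d] same[of a c] same[of b d]
      by (intro exI[of _ a] exI[of _ b] exI[of _ c] exI[of _ d]) auto
  qed
qed

section \<open>Runs indexed by time, and the bound on visits\<close>

definition path :: "('b, 'p, 'a) twoway \<Rightarrow> 'b list \<Rightarrow> nat \<Rightarrow> (nat \<Rightarrow> int \<times> 'p) \<Rightarrow> (nat \<Rightarrow> 'a list) \<Rightarrow> bool" where
  "path N w n c b \<longleftrightarrow> (\<forall>t<n. 0 \<le> fst (c t) \<and> fst (c t) < int (length w) \<and>
     N (w ! nat (fst (c t))) (snd (c t)) (snd (c (Suc t)), b t, fst (c (Suc t)) - fst (c t)))"

lemma nrun_path:
  assumes "nrun N w n c0 v c1"
  shows "\<exists>c b. path N w n c b \<and> c 0 = c0 \<and> c n = c1 \<and> v = concat (map b [0..<n])"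
  using assms
proof induction
  case (nrun_refl c)
  then show ?case by (intro exI[of _ "\<lambda>_. c"]) (simp add: path_def)
next
  case (nrun_step i p p' o1 e n o2 c')
  then obtain c b where cb: "path N w n c b" "c 0 = (i + e, p')" "c n = c'" "o2 = concat (map b [0..<n])"
    by blast
  let ?c = "case_nat (i, p) c" and ?b = "case_nat o1 b"
  have "path N w (Suc n) ?c ?b"
    unfolding path_def
  proof (intro allI impI)
    fix t assume "t < Suc n"
    then show "0 \<le> fst (?c t) \<and> fst (?c t) < int (length w) \<and>
      N (w ! nat (fst (?c t))) (snd (?c t)) (snd (?c (Suc t)), ?b t, fst (?c (Suc t)) - fst (?c t))"
      using cb(1,2) nrun_step.hyps(1-3) by (cases t) (auto simp: path_def)
  qed
  moreover have "o1 @ o2 = concat (map ?b [0..<Suc n])"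
    by (simp add: cb(4) upt_conv_Cons map_Suc_upt[symmetric] comp_def del: upt_Suc)
  ultimately show ?case using cb(3) by (intro exI[of _ ?c] exI[of _ ?b]) auto
qed

lemma path_nrun:
  assumes "path N w n c b" "i \<le> j" "j \<le> n"
  shows "nrun N w (j - i) (c i) (concat (map b [i..<j])) (c j)"
  using assms(2,3)
proof (induction j rule: dec_induct)
  case base
  then show ?case by (simp add: nrun_refl)
next
  case (step k)
  have "nrun N w (Suc (k - i)) (c i) (concat (map b [i..<k]) @ b k) (fst (c k) + (fst (c (Suc k)) - fst (c k)), snd (c (Suc k)))"
    by (rule nrun_snoc[where q = "snd (c k)"]) (use step assms(1) in \<open>auto simp: path_def\<close>)
  then show ?case using step.hyps by (simp add: Suc_diff_le)
qed

lemma nrun_trans: "nrun D v m c o1 c1 \<Longrightarrow> nrun D v n c1 o2 c2 \<Longrightarrow> nrun D v (m + n) c (o1 @ o2) c2"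
  by (induction rule: nrun.induct) (auto intro: nrun_step)

lemma run_replicate: "run N w c v c \<Longrightarrow> run N w c (concat (replicate n v)) c"
  by (induction n) (auto intro: run_trans)

lemma infinite_unbounded_lists:
  assumes "\<And>n::nat. \<exists>x\<in>A. n \<le> length x"
  shows "infinite A"
proof
  assume "finite A"
  then have "finite (length ` A)" by simp
  then obtain m where "\<forall>l\<in>length ` A. l < m" using finite_nat_set_iff_bounded by blast
  then show False using assms[of m] by force
qed

text \<open>\<open>K\<close> is the Ramsey number for colouring by behaviours. It depends on the
  reader only and is uniform in the writer, its input and the output, as a fixed set of labels
  requires.\<close>

lemma (in machine) bounded_visits:
  assumes "finite Q"
  shows "\<exists>K. \<forall>(N :: ('b, 'p, 'a) twoway) w c0 c1 v q0 q1 os.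
    q0 \<in> Q \<longrightarrow> run N w c0 v c1 \<longrightarrow> run D v (0, q0) os (int (length v), q1) \<longrightarrow>
    finite {os. \<exists>v. run N w c0 v c1 \<and> run D v (0, q0) os (int (length v), q1)} \<longrightarrow>
    (\<exists>n c b. path N w n c b \<and> c 0 = c0 \<and> c n = c1 \<and>
       run D (concat (map b [0..<n])) (0, q0) os (int (length (concat (map b [0..<n]))), q1) \<and>
       (\<forall>x. card {t. t < n \<and> c t = x} < K))"
proof -
  define C where "C = Pow (((UNIV :: bool set) \<times> Q) \<times> ((UNIV :: bool set) \<times> Q) \<times> (UNIV :: bool set))"
  have "finite C" using assms by (simp add: C_def)
  from ramsey_idempotent[OF this] obtain K where K: "\<And>S f. K \<le> card (S :: nat set) \<Longrightarrow> finite S \<Longrightarrow>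
    (\<forall>i j. f i j \<in> C) \<Longrightarrow> (\<exists>a b c d. {a, b, c, d} \<subseteq> S \<and> a < b \<and> b < c \<and> c < d \<and>
       f a b = f b c \<and> f c d = f b c \<and> f a c = f b c \<and> f b d = f b c)" by metis
  show ?thesis
  proof (rule exI[of _ K], intro allI impI)
    fix N :: "('b, 'p, 'a) twoway" and w c0 c1 v q0 q1 os
    assume q0: "q0 \<in> Q" and r: "run N w c0 v c1" and rD: "run D v (0, q0) os (int (length v), q1)"
      and fin: "finite {os. \<exists>v. run N w c0 v c1 \<and> run D v (0, q0) os (int (length v), q1)}"
    \<comment> \<open>The intermediate word is quantified inside, so a shorter run may produce a
      different word, provided the reader still produces \<open>os\<close>.\<close>
    define P where "P n \<longleftrightarrow> (\<exists>v. nrun N w n c0 v c1 \<and> run D v (0, q0) os (int (length v), q1))" for n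
    have "\<exists>n. P n" using r rD unfolding P_def run_def[of N] by blast
    define n where "n = (LEAST n. P n)"
    have "P n" unfolding n_def using \<open>\<exists>n. P n\<close> by (rule LeastI_ex)
    then obtain v where v: "nrun N w n c0 v c1" "run D v (0, q0) os (int (length v), q1)"
      unfolding P_def by blast
    from nrun_path[OF v(1)] obtain c b where cb: "path N w n c b" "c 0 = c0" "c n = c1"
      "v = concat (map b [0..<n])" by blast
    have "card {t. t < n \<and> c t = x} < K" for x
    proof (rule ccontr)
      assume "\<not> card {t. t < n \<and> c t = x} < K"
      then have "K \<le> card {t. t < n \<and> c t = x}" by simp
      from K[OF this, of "\<lambda>i j. behaviour (concat (map b [i..<j]))"]
      obtain t1 t2 t3 t4 where t: "{t1, t2, t3, t4} \<subseteq> {t. t < n \<and> c t = x}" "t1 < t2" "t2 < t3" "t3 < t4"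
        and eq: "behaviour (concat (map b [t1..<t2])) = behaviour (concat (map b [t2..<t3]))"
          "behaviour (concat (map b [t3..<t4])) = behaviour (concat (map b [t2..<t3]))"
          "behaviour (concat (map b [t1..<t3])) = behaviour (concat (map b [t2..<t3]))"
        using behaviour_subset by (auto simp: C_def)
      define w' where "w' i j = concat (map b [i..<j])" for i j
      have sp: "w' i k = w' i j @ w' j k" if "i \<le> j" "j \<le> k" for i j k
        using that upt_add_eq_append[of i j "k - j"] by (simp add: w'_def)
      interpret idempotent D Q "w' t1 t2" "w' t2 t3" "w' t3 t4"
      proof
        \<comment> \<open>One copy is exchanged for the equivalent factor just before it; the
          product is then the factor from \<open>t1\<close> to \<open>t3\<close>, which has the same
          colour.\<close>
        have "behaviour (w' t2 t3 @ w' t2 t3) = behaviour (w' t1 t2 @ w' t2 t3)"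
          by (rule behaviour_append) (simp_all add: eq w'_def)
        also have "w' t1 t2 @ w' t2 t3 = w' t1 t3" using sp[of t1 t2 t3] t by simp
        finally show "behaviour (w' t2 t3 @ w' t2 t3) = behaviour (w' t2 t3)"
          using eq by (simp add: w'_def)
      qed (use eq in \<open>simp_all add: w'_def\<close>)
      have c: "c t1 = x" "c t2 = x" "c t3 = x" "c t4 = x" "t4 < n" using t by auto
      have nr: "nrun N w (j - i) (c i) (w' i j) (c j)" if "i \<le> j" "j \<le> n" for i j
        using path_nrun[OF cb(1) that] by (simp add: w'_def)
      have "v = w' 0 t1 @ M 1 @ w' t4 n"
        using t c sp[of 0 t1 n] sp[of t1 t2 n] sp[of t2 t3 n] sp[of t3 t4 n]
        by (simp add: cb(4) w'_def[of 0 n, symmetric] M_def)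
      from run_M[OF v(2)[unfolded this] q0] show False
      proof
        assume A: "run D (w' 0 t1 @ M 0 @ w' t4 n) (0, q0) os (int (length (w' 0 t1 @ M 0 @ w' t4 n)), q1)"
        \<comment> \<open>The run jumps from time \<open>t2\<close> to time \<open>t3\<close>, at
          which the configuration is the same, and thus saves \<open>t3 - t2\<close> steps.\<close>
        have "nrun N w ((t1 - 0) + ((t2 - t1) + ((t4 - t3) + (n - t4)))) (c 0)
          (w' 0 t1 @ w' t1 t2 @ w' t3 t4 @ w' t4 n) (c n)"
          using t c nr[of 0 t1] nr[of t1 t2] nr[of t3 t4] nr[of t4 n] by (intro nrun_trans) auto
        then have "nrun N w ((t1 - 0) + ((t2 - t1) + ((t4 - t3) + (n - t4)))) c0 (w' 0 t1 @ M 0 @ w' t4 n) c1"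
          by (simp add: M_def cb)
        with A have "P ((t1 - 0) + ((t2 - t1) + ((t4 - t3) + (n - t4))))"
          unfolding P_def by blast
        then have "n \<le> (t1 - 0) + ((t2 - t1) + ((t4 - t3) + (n - t4)))"
          unfolding n_def by (rule Least_le)
        then show False using t c by linarith
      next
        assume A: "\<forall>m. \<exists>os'. m \<le> length os' \<and>
          run D (w' 0 t1 @ M m @ w' t4 n) (0, q0) os' (int (length (w' 0 t1 @ M m @ w' t4 n)), q1)"
        have nr': "run N w (c i) (w' i j) (c j)" if "i \<le> j" "j \<le> n" for i j
          using nr[OF that] unfolding run_def by blast
        have l: "run N w (c t2) (concat (replicate m (w' t2 t3))) (c t3)" for m
          using run_replicate[of N w x "w' t2 t3"] nr'[of t2 t3] t c by simp
        have "run N w c0 (w' 0 t1 @ M m @ w' t4 n) c1" for m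
          unfolding M_def append_assoc cb(2,3)[symmetric]
          by (intro run_trans[OF nr' run_trans[OF nr' run_trans[OF l run_trans[OF nr' nr']]]])
            (use t c in auto)
        then have "infinite {os. \<exists>v. run N w c0 v c1 \<and> run D v (0, q0) os (int (length v), q1)}"
          using A by (intro infinite_unbounded_lists) blast
        then show False using fin by simp
      qed
    qed
    then show "\<exists>n c b. path N w n c b \<and> c 0 = c0 \<and> c n = c1 \<and>
       run D (concat (map b [0..<n])) (0, q0) os (int (length (concat (map b [0..<n]))), q1) \<and>
       (\<forall>x. card {t. t < n \<and> c t = x} < K)"
      using cb v(2) by blast
  qed
qed

section \<open>Walking along a guessed run\<close>

text \<open>Symbols and states of a 2gsm are numbers. Letters are only decoded, so that
  \<open>y\<close> may be any list of numbers, while the states of \<open>E\<close> are always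
  codes.\<close>

lemma run_encode:
  fixes W :: "('l :: countable, 'x :: countable, 'o) twoway"
  defines "E \<equiv> \<lambda>a x r. \<exists>st st' os e. x = to_nat st \<and> r = (to_nat st', os, e) \<and> W (from_nat a) st (st', os, e)"
  shows "run E y (i, to_nat st) os (j, to_nat st') \<longleftrightarrow> run W (map from_nat y) (i, st) os (j, st')"
proof
  have "\<exists>st'. snd c' = to_nat st' \<and> run W (map from_nat y) (fst c, st) os (fst c', st')"
    if "run E y c os c'" "snd c = to_nat st" for c os c' st
    using that
  proof (induction arbitrary: st rule: run_induct)
    case (step i q q' o1 e o2 c')
    obtain st1 where st1: "q' = to_nat st1" "W (from_nat (y ! nat i)) st (st1, o1, e)"
      using step.hyps(3) step.prems by (auto simp: E_def)
    obtain st' where st': "snd c' = to_nat st'" "run W (map from_nat y) (i + e, st1) o2 (fst c', st')"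
      using step.IH[of st1] st1 by auto
    have "run W (map from_nat y) (i, st) (o1 @ o2) (fst c', st')"
      by (rule run_step[OF _ _ _ st'(2)]) (use step.hyps st1 in auto)
    then show ?case using st' by auto
  qed auto
  from this[of "(i, to_nat st)" os "(j, to_nat st')" st]
  show "run E y (i, to_nat st) os (j, to_nat st') \<Longrightarrow> run W (map from_nat y) (i, st) os (j, st')" by auto
next
  have "run E y (fst c, to_nat (snd c)) os (fst c', to_nat (snd c'))"
    if "run W (map from_nat y) c os c'" for c os c'
    using that
  proof (induction rule: run_induct)
    case (step i q q' o1 e o2 c')
    have "E (y ! nat i) (to_nat q) (to_nat q', o1, e)"
      using step.hyps by (auto simp: E_def)
    then show ?case using run_step[of i y E "to_nat q" "to_nat q'" o1 e o2] step by simp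
  qed simp
  from this[of "(i, st)" os "(j, st')"]
  show "run W (map from_nat y) (i, st) os (j, st') \<Longrightarrow> run E y (i, to_nat st) os (j, to_nat st')" by simp
qed

section \<open>Labels that record the steps of the writer in a cell\<close>

text \<open>A node is a writer state with the number of its visit to the cell. An
  \<open>info\<close> holds the output of the step, the next node with the head move to it, and the
  previous node with the head move from it (\<open>None\<close> at the start of the run).\<close>

type_synonym 'p node = "'p \<times> nat"
type_synonym 'p link = "'p node \<times> int"
type_synonym 'p info = "nat list \<times> 'p link \<times> 'p link option"
type_synonym 'p label = "('p node \<times> 'p info) list"
type_synonym 'p wstate = "(bool \<times> nat \<times> 'p node \<times> 'p link option) option"

text \<open>\<open>PF\<close> has no outgoing steps and is entered without moving, so the walker is
  still on the tape when it gets there and can accept.\<close>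

locale walker = machine D Q for D :: "(nat, nat, nat) twoway" and Q +
  fixes N :: "('b, 'p :: countable, nat) twoway" and W :: "'p set" and B :: "nat list set"
    and P0 PF :: 'p and q0 qf K :: nat and S :: "'b set"
  assumes fin: "finite Q" "finite W" "finite B" "finite S"
    and N: "N s P (P', \<beta>, e) \<Longrightarrow> P \<in> W \<and> P' \<in> W \<and> \<beta> \<in> B \<and> e \<in> {-1, 0, 1} \<and> P \<noteq> PF \<and> (P' = PF \<longrightarrow> e = 0)"
    and P0: "P0 \<in> W" "P0 \<noteq> PF" and q0: "q0 \<in> Q" and K: "0 < K"
begin

abbreviation nodes :: "'p node set" where "nodes \<equiv> W \<times> {..<K}"
abbreviation links :: "'p link set" where "links \<equiv> nodes \<times> {-1, 0, 1}"

definition entries :: "('p node \<times> 'p info) set" where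
  "entries = {p \<in> nodes. fst p \<noteq> PF} \<times> B \<times> links \<times> insert None (Some ` links)"

text \<open>Legality of a step depends on the symbol of its cell alone and is enforced by the
  relabelling; agreement between cells is left to the walk.\<close>

definition local_entries :: "'b \<Rightarrow> ('p node \<times> 'p info) set" where
  "local_entries s = {(p, \<beta>, (p', e), pv). (p, \<beta>, (p', e), pv) \<in> entries \<and> N s (fst p) (fst p', \<beta>, e)}"

definition labels :: "'b \<Rightarrow> 'p label set" where
  "labels s = {l. set l \<subseteq> local_entries s \<and> length l \<le> card (local_entries s)}"

lemma finite_entries: "finite entries"
  using fin by (auto simp: entries_def)

lemma finite_local_entries: "finite (local_entries s)"
  by (rule finite_subset[OF _ finite_entries]) (auto simp: local_entries_def)

lemma finite_labels: "finite (labels s)"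
  unfolding labels_def using finite_lists_length_le[OF finite_local_entries] by simp

text \<open>
  A state \<open>(s, q, p, chk)\<close> simulates \<open>D\<close> entering in state \<open>q\<close> the block written at node \<open>p\<close> of the guessed
  run. The component \<open>chk\<close> is the link by which \<open>p\<close> was reached and must occur in the label of \<open>p\<close>;
  this makes every walk correct even on an inconsistent guess.
\<close>

inductive walk :: "('p label, 'p wstate, nat) twoway" where
  accepted: "walk l None (None, [], 1)"
| accept: "fst p = PF \<Longrightarrow> walk l (Some (True, qf, p, chk)) (None, [], 1)"
| forward: "\<lbrakk>map_of l p = Some (\<beta>, (p', e), pv); (p, \<beta>, (p', e), pv) \<in> entries; q \<in> Q;
    chk = (if s then pv else Some (p', e)); run D \<beta> (ent s \<beta>, q) os (exi True \<beta>, q')\<rbrakk>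
    \<Longrightarrow> walk l (Some (s, q, p, chk)) (Some (True, q', p', Some (p, e)), os, e)"
| backward: "\<lbrakk>map_of l p = Some (\<beta>, nx, Some (p', e)); (p, \<beta>, nx, Some (p', e)) \<in> entries; q \<in> Q;
    chk = (if s then Some (p', e) else Some nx); run D \<beta> (ent s \<beta>, q) os (exi False \<beta>, q')\<rbrakk>
    \<Longrightarrow> walk l (Some (s, q, p, chk)) (Some (False, q', p', Some (p, e)), os, - e)"

text \<open>\<open>map_of\<close> fixes the entry of the node, and the deterministic reader fixes
  the side on which it leaves the block. Accepting cannot compete with moving, as
  \<open>entries\<close> contains no node of state \<open>PF\<close>.\<close>

lemma deterministic_walk: "deterministic walk"
  unfolding deterministic_def
proof (intro allI impI)
  fix l x y z assume "walk l x y" "walk l x z"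
  have 1: "o1 = o2 \<and> s = s' \<and> q = q'"
    if "run D \<beta> c o1 (exi s \<beta>, q)" "run D \<beta> c o2 (exi s' \<beta>, q')" for \<beta> c o1 s q o2 s' q'
    using run_det_exit[OF that(1) exi_outside that(2) exi_outside det] exi_inj by metis
  show "y = z" using \<open>walk l x z\<close> \<open>walk l x y\<close>
  proof cases
    case accepted
    from \<open>walk l x y\<close> show ?thesis by cases (use accepted in auto)
  next
    case accept
    from \<open>walk l x y\<close> show ?thesis by cases (use accept in \<open>auto simp: entries_def\<close>)
  next
    case (forward p \<beta> p' e pv q chk s os q')
    from \<open>walk l x y\<close> show ?thesis
      by cases (use forward in \<open>auto simp: entries_def dest: 1\<close>)
  next
    case (backward p \<beta> nx p' e q chk s os q')
    from \<open>walk l x y\<close> show ?thesis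
      by cases (use backward in \<open>auto simp: entries_def dest: 1\<close>)
  qed
qed

lemma unit_moves_walk: "unit_moves walk"
  unfolding unit_moves_def by (auto elim!: walk.cases simp: entries_def)

definition wstates :: "'p wstate set" where
  "wstates = insert None (Some ` (UNIV \<times> Q \<times> nodes \<times> insert None (Some ` links)))"

lemma finite_wstates: "finite wstates"
  using fin by (simp add: wstates_def)

lemma closed_walk:
  assumes "walk l st (st', os, e)"
  shows "st' \<in> wstates"
  using assms
proof cases
  case (forward p \<beta> p' pv q chk s q')
  then show ?thesis using run_closed[OF forward(7)] by (auto simp: wstates_def entries_def)
next
  case (backward p \<beta> nx p' e' q chk s q')
  then show ?thesis using run_closed[OF backward(8)] by (auto simp: wstates_def entries_def)
qed (simp_all add: wstates_def)

section \<open>A consistent chain of labels can be walked\<close>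

text \<open>The links of neighbouring nodes agree in both directions. Nothing is demanded of the
  label of the last node \<open>pp n\<close>, so a chain can end where inspection has
  stopped.\<close>

definition linked :: "'p label list \<Rightarrow> nat \<Rightarrow> (nat \<Rightarrow> int) \<Rightarrow> (nat \<Rightarrow> 'p node) \<Rightarrow> (nat \<Rightarrow> nat list) \<Rightarrow> (nat \<Rightarrow> int) \<Rightarrow> bool" where
  "linked y n ii pp bb ee \<longleftrightarrow> ii 0 = 0 \<and> pp 0 = (P0, 0) \<and>
    (\<forall>t<n. 0 \<le> ii t \<and> ii t < int (length y) \<and> ii (Suc t) = ii t + ee t \<and>
      map_of (y ! nat (ii t)) (pp t) =
        Some (bb t, (pp (Suc t), ee t), if t = 0 then None else Some (pp (t - 1), ee (t - 1))) \<and>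
      (pp t, bb t, (pp (Suc t), ee t), if t = 0 then None else Some (pp (t - 1), ee (t - 1))) \<in> entries)"

text \<open>The walker at the entry of block \<open>t\<close>: the link to be checked is the one of
  step \<open>t - 1\<close> when coming from the left, and of step \<open>t\<close> when coming back
  from the right.\<close>

definition cfg :: "(nat \<Rightarrow> int) \<Rightarrow> (nat \<Rightarrow> 'p node) \<Rightarrow> (nat \<Rightarrow> int) \<Rightarrow> nat \<Rightarrow> bool \<Rightarrow> nat \<Rightarrow> int \<times> 'p wstate" where
  "cfg ii pp ee t s q = (ii t, Some (s, q, pp t,
     if s then if t = 0 then None else Some (pp (t - 1), ee (t - 1)) else Some (pp (Suc t), ee t)))"

lemma walk_blk_run:
  assumes "run (blk D) (map bb [0..<n]) c os c'" "linked y n ii pp bb ee"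
    "c = (int t, (s, q))" "c' = (int n, (True, qf))" "q \<in> Q"
  shows "run walk y (cfg ii pp ee t s q) os (cfg ii pp ee n True qf)"
  using assms(1,3-)
proof (induction arbitrary: t s q rule: run_induct)
  case (step i p p' o1 e o2 c')
  obtain s' q' where p': "p' = (s', q')" by (cases p')
  have t: "i = int t" "p = (s, q)" "t < n" using step by auto
  have b: "run D (bb t) (ent s (bb t), q) o1 (exi s' (bb t), q')" "e = dir s'"
    using step.hyps(3) t p' by (auto simp: blk_iff)
  have q': "q' \<in> Q" using run_closed[OF b(1)] step.prems by simp
  have y: "0 \<le> ii t" "ii t < int (length y)" "ii (Suc t) = ii t + ee t"
      "map_of (y ! nat (ii t)) (pp t) =
        Some (bb t, (pp (Suc t), ee t), if t = 0 then None else Some (pp (t - 1), ee (t - 1)))"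
      "(pp t, bb t, (pp (Suc t), ee t), if t = 0 then None else Some (pp (t - 1), ee (t - 1))) \<in> entries"
    using assms(2) t(3) by (auto simp: linked_def)
  show ?case
  proof (cases s')
    case True
    have "walk (y ! nat (ii t)) (snd (cfg ii pp ee t s q)) (snd (cfg ii pp ee (Suc t) True q'), o1, ee t)"
      unfolding cfg_def snd_conv using forward[OF y(4,5) step.prems(3) refl, of s o1 q'] b(1) True by simp
    from run_step1[where D = walk and v = y, OF y(1,2) this] y(3)
    have 1: "run walk y (cfg ii pp ee t s q) o1 (cfg ii pp ee (Suc t) True q')"
      by (simp add: cfg_def)
    have "run walk y (cfg ii pp ee (Suc t) True q') o2 (cfg ii pp ee n True qf)"
      by (rule step.IH) (use t p' True b(2) q' step.prems in \<open>auto simp: dir_def\<close>)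
    then show ?thesis using run_trans[OF 1] by simp
  next
    case False
    \<comment> \<open>Leaving block 0 to the left would strand the reader at position -1, away from
      its goal \<open>n\<close>.\<close>
    have "t \<noteq> 0"
    proof
      assume "t = 0"
      then have "run (blk D) (map bb [0..<n]) (-1, p') o2 c'"
        using step.hyps(4) t b(2) False by (simp add: dir_def)
      from run_outside[OF this] show False using step.prems by simp
    qed
    then obtain u where u: "t = Suc u" using not0_implies_Suc by blast
    have "u < n" using t u by simp
    then have ii: "ii t = ii u + ee u" using assms(2) u by (auto simp: linked_def)
    have y': "map_of (y ! nat (ii t)) (pp t) = Some (bb t, (pp (Suc t), ee t), Some (pp u, ee u))"
      "(pp t, bb t, (pp (Suc t), ee t), Some (pp u, ee u)) \<in> entries"
      using y(4,5) by (simp_all add: u)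
    have "walk (y ! nat (ii t)) (snd (cfg ii pp ee t s q)) (snd (cfg ii pp ee u False q'), o1, - ee u)"
      using backward[OF y'(1,2) step.prems(3) refl, of s o1 q'] b(1) False u
      by (cases s) (simp_all add: cfg_def)
    from run_step1[where D = walk and v = y, OF y(1,2) this] ii
    have 1: "run walk y (cfg ii pp ee t s q) o1 (cfg ii pp ee u False q')"
      by (simp add: cfg_def)
    have "run walk y (cfg ii pp ee u False q') o2 (cfg ii pp ee n True qf)"
      by (rule step.IH) (use t p' False b(2) q' u step.prems in \<open>auto simp: dir_def\<close>)
    then show ?thesis using run_trans[OF 1] by simp
  qed
qed (auto)

text \<open>Acceptance is by leaving the word to the right, so the walker finally runs silently to
  that end.\<close>

lemma run_accepted:
  assumes "0 \<le> i" "i \<le> int (length y)"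
  shows "run walk y (i, None) [] (int (length y), None)"
  using assms
proof (induction "nat (int (length y) - i)" arbitrary: i)
  case (Suc m)
  then show ?case
    using run_step[of i y walk None None "[]" 1 "[]", OF _ _ accepted] by simp
qed simp

definition wstart :: "'p wstate" where
  "wstart = Some (True, q0, (P0, 0), None)"

lemma walk_complete:
  assumes "linked y n ii pp bb ee" "run (blk D) (map bb [0..<n]) (0, (True, q0)) os (int n, (True, qf))"
    "fst (pp n) = PF" "0 \<le> ii n" "ii n < int (length y)"
  shows "run walk y (0, wstart) os (int (length y), None)"
proof -
  have 1: "run walk y (cfg ii pp ee 0 True q0) os (cfg ii pp ee n True qf)"
    using walk_blk_run[OF assms(2,1), of 0 True q0] q0 by simp
  have 2: "run walk y (cfg ii pp ee n True qf) [] (ii n + 1, None)"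
    unfolding cfg_def by (rule run_step1[OF assms(4,5)], rule accept, rule assms(3))
  have "cfg ii pp ee 0 True q0 = (0, wstart)"
    using assms(1) by (simp add: cfg_def wstart_def linked_def)
  then show ?thesis
    using run_trans[OF run_trans[OF 1 2] run_accepted] assms(4,5) by simp
qed

section \<open>Every accepting walk follows a consistent chain\<close>

text \<open>Soundness invariant for arbitrary labels: \<open>n\<close> tells how far a consistent
  chain has been discovered. Its end can only have been reached in forward motion, whence
  \<open>s\<close> for \<open>t = n\<close>.\<close>

definition traces :: "'p label list \<Rightarrow> nat \<Rightarrow> (nat \<Rightarrow> int) \<Rightarrow> (nat \<Rightarrow> 'p node) \<Rightarrow> (nat \<Rightarrow> nat list) \<Rightarrow>
    (nat \<Rightarrow> int) \<Rightarrow> nat list \<Rightarrow> int \<times> 'p wstate \<Rightarrow> bool" where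
  "traces y n ii pp bb ee os c \<longleftrightarrow> linked y n ii pp bb ee \<and>
    (case snd c of None \<Rightarrow> fst (pp n) = PF \<and> run (blk D) (map bb [0..<n]) (0, (True, q0)) os (int n, (True, qf))
     | Some (s, q, r) \<Rightarrow> \<exists>t\<le>n. (t = n \<longrightarrow> s) \<and> c = cfg ii pp ee t s q \<and>
         run (blk D) (map bb [0..<n]) (0, (True, q0)) os (int t, (s, q)))"

lemma tracesI:
  assumes "linked y n ii pp bb ee" "t \<le> n" "t = n \<longrightarrow> s"
    "run (blk D) (map bb [0..<n]) (0, (True, q0)) os (int t, (s, q))" "c = cfg ii pp ee t s q"
  shows "traces y n ii pp bb ee os c"
proof -
  obtain r where r: "snd c = Some (s, q, r)" using assms(5) by (simp add: cfg_def)
  have "\<exists>t'\<le>n. (t' = n \<longrightarrow> s) \<and> c = cfg ii pp ee t' s q \<and>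
      run (blk D) (map bb [0..<n]) (0, (True, q0)) os (int t', (s, q))"
    using assms(2-5) by (intro exI[of _ t]) simp
  then show ?thesis unfolding traces_def r using assms(1) by simp
qed

lemma walk_traces:
  assumes "run walk y (0, wstart) os c"
  shows "\<exists>n ii pp bb ee. traces y n ii pp bb ee os c"
  using assms
proof (induction rule: run_rev_induct)
  case refl
  show ?case
  proof -
    have "traces y 0 (\<lambda>_. 0) (\<lambda>_. (P0, 0)) (\<lambda>_. []) (\<lambda>_. 0) [] (0, wstart)"
      by (simp add: traces_def linked_def wstart_def cfg_def)
    then show ?thesis by blast
  qed
next
  case (step i st st' o1 e o2)
  from step.IH obtain n ii pp bb ee where IH: "linked y n ii pp bb ee"
    "case st of None \<Rightarrow> fst (pp n) = PF \<and> run (blk D) (map bb [0..<n]) (0, (True, q0)) o1 (int n, (True, qf))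
     | Some (s, q, r) \<Rightarrow> \<exists>t\<le>n. (t = n \<longrightarrow> s) \<and> (i, st) = cfg ii pp ee t s q \<and>
         run (blk D) (map bb [0..<n]) (0, (True, q0)) o1 (int t, (s, q))"
    by (auto simp: traces_def)
  \<comment> \<open>Once the label of the current node is read, the chain may be taken to extend
    beyond it: either it already does, or its end is reached and the entry is appended, its
    predecessor link having been compared with \<open>chk\<close>. This holds also before a step
    back.\<close>
  have ext: "\<exists>n ii pp bb ee t. linked y n ii pp bb ee \<and> t < n \<and> (i, st) = cfg ii pp ee t s q \<and>
      run (blk D) (map bb [0..<n]) (0, (True, q0)) o1 (int t, (s, q)) \<and>
      (\<beta>, p', e', pv) = (bb t, pp (Suc t), ee t, if t = 0 then None else Some (pp (t - 1), ee (t - 1)))"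
    if st: "st = Some (s, q, p, chk)" and l: "map_of (y ! nat i) p = Some (\<beta>, (p', e'), pv)"
      "(p, \<beta>, (p', e'), pv) \<in> entries" "chk = (if s then pv else Some (p', e'))"
    for s q p chk \<beta> p' e' pv
  proof -
    from IH(2) st obtain t where t: "t \<le> n" "t = n \<longrightarrow> s" "(i, st) = cfg ii pp ee t s q"
      "run (blk D) (map bb [0..<n]) (0, (True, q0)) o1 (int t, (s, q))" by auto
    then have i: "i = ii t" "p = pp t" by (auto simp: cfg_def st)
    show ?thesis
    proof (cases "t < n")
      case True
      then have "map_of (y ! nat (ii t)) (pp t) =
        Some (bb t, (pp (Suc t), ee t), if t = 0 then None else Some (pp (t - 1), ee (t - 1)))"
        using IH(1) by (simp add: linked_def)
      then have "(\<beta>, p', e', pv) = (bb t, pp (Suc t), ee t, if t = 0 then None else Some (pp (t - 1), ee (t - 1)))"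
        using l(1) i by simp
      then show ?thesis using True t IH(1) by blast
    next
      case False
      then have tn: "t = n" "s" using t by auto
      have pv: "pv = (if n = 0 then None else Some (pp (n - 1), ee (n - 1)))"
        using t(3) l(3) tn by (simp add: st cfg_def)
      let ?ii = "ii(Suc n := ii n + e')" and ?pp = "pp(Suc n := p')" and ?bb = "bb(n := \<beta>)" and ?ee = "ee(n := e')"
      have "linked y (Suc n) ?ii ?pp ?bb ?ee"
        unfolding linked_def
      proof (rule conjI[OF _ conjI[OF _ allI[OF impI]]])
        show "?ii 0 = 0" "?pp 0 = (P0, 0)" using IH(1) by (auto simp: linked_def)
        fix k assume "k < Suc n"
        then consider "k < n" | "k = n" by linarith
        then show "0 \<le> ?ii k \<and> ?ii k < int (length y) \<and> ?ii (Suc k) = ?ii k + ?ee k \<and>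
          map_of (y ! nat (?ii k)) (?pp k) =
            Some (?bb k, (?pp (Suc k), ?ee k), if k = 0 then None else Some (?pp (k - 1), ?ee (k - 1))) \<and>
          (?pp k, ?bb k, (?pp (Suc k), ?ee k), if k = 0 then None else Some (?pp (k - 1), ?ee (k - 1))) \<in> entries"
        proof cases
          case 1
          have "0 \<le> ii k \<and> ii k < int (length y) \<and> ii (Suc k) = ii k + ee k \<and>
            map_of (y ! nat (ii k)) (pp k) =
              Some (bb k, (pp (Suc k), ee k), if k = 0 then None else Some (pp (k - 1), ee (k - 1))) \<and>
            (pp k, bb k, (pp (Suc k), ee k), if k = 0 then None else Some (pp (k - 1), ee (k - 1))) \<in> entries"
            using IH(1) 1 unfolding linked_def by blast
          moreover have "?ii k = ii k" "?ii (Suc k) = ii (Suc k)" "?pp k = pp k" "?pp (Suc k) = pp (Suc k)"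
            "?pp (k - 1) = pp (k - 1)" "?bb k = bb k" "?ee k = ee k" "?ee (k - 1) = ee (k - 1)"
            using 1 by auto
          ultimately show ?thesis by presburger
        next
          case 2
          have "?ii k = i" "?ii (Suc k) = i + e'" "?pp k = p" "?pp (Suc k) = p'"
            "?pp (k - 1) = pp (k - 1)" "?bb k = \<beta>" "?ee k = e'" "k \<noteq> 0 \<longrightarrow> ?ee (k - 1) = ee (k - 1)"
            using 2 i tn by auto
          then show ?thesis using l(1,2) pv step.hyps(2,3) 2 by (simp split del: if_split cong: if_cong)
        qed
      qed
      moreover have "(i, st) = cfg ?ii ?pp ?ee n s q"
        using t(3) tn by (cases n) (simp_all add: cfg_def)
      moreover have "run (blk D) (map ?bb [0..<Suc n]) (0, (True, q0)) o1 (int n, (s, q))"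
        using run_prefix[OF t(4), of "[\<beta>]"] tn by simp
      moreover have "(\<beta>, p', e', pv) = (?bb n, ?pp (Suc n), ?ee n, if n = 0 then None else Some (?pp (n - 1), ?ee (n - 1)))"
        using pv by (cases n) simp_all
      ultimately show ?thesis by blast
    qed
  qed
  from step.hyps(4) show ?case
  proof cases
    case accepted
    then have "traces y n ii pp bb ee (o1 @ o2) (i + e, st')" using IH by (simp add: traces_def)
    then show ?thesis by blast
  next
    case (accept p chk)
    then obtain t where t: "t \<le> n" "(i, st) = cfg ii pp ee t True qf"
      "run (blk D) (map bb [0..<n]) (0, (True, q0)) o1 (int t, (True, qf))" using IH(2) by auto
    have "fst (pp t) = PF" using t(2) accept by (simp add: cfg_def)
    \<comment> \<open>A node of state \<open>PF\<close> has no entry, so it can only be the end of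
      the chain.\<close>
    then have "t = n" using t(1) IH(1) by (cases "t < n") (auto simp: linked_def entries_def)
    then have "traces y n ii pp bb ee (o1 @ o2) (i + e, st')"
      using t IH(1) accept \<open>fst (pp t) = PF\<close> by (simp add: traces_def)
    then show ?thesis by blast
  next
    case (forward p \<beta> p' pv q chk s q')
    from ext[OF forward(1,3,4,6)] obtain n ii pp bb ee t where
      1: "linked y n ii pp bb ee" "t < n" "(i, st) = cfg ii pp ee t s q"
        "run (blk D) (map bb [0..<n]) (0, (True, q0)) o1 (int t, (s, q))"
        "(\<beta>, p', e, pv) = (bb t, pp (Suc t), ee t, if t = 0 then None else Some (pp (t - 1), ee (t - 1)))"
      by blast
    have "blk D (map bb [0..<n] ! nat (int t)) (s, q) ((True, q'), o2, 1)"
      using forward(7) 1(2,5) by (simp add: blk_iff dir_def)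
    then have "run (blk D) (map bb [0..<n]) (0, (True, q0)) (o1 @ o2) (int (Suc t), (True, q'))"
      using run_trans[OF 1(4) run_step1[where D = "blk D"], of "(True, q')" o2 1] 1(2) by (simp add: add.commute)
    moreover have "(i + e, st') = cfg ii pp ee (Suc t) True q'"
      using 1 forward(1,2) by (simp add: cfg_def linked_def)
    ultimately have "traces y n ii pp bb ee (o1 @ o2) (i + e, st')"
      using tracesI[OF 1(1), of "Suc t" True] 1(2) by simp
    then show ?thesis by blast
  next
    case (backward p \<beta> nx p' e' q chk s q')
    obtain p1 e1 where nx: "nx = (p1, e1)" by (cases nx)
    have chk: "chk = (if s then Some (p', e') else Some (p1, e1))" using backward nx by simp
    from ext[OF backward(1) backward(4,5)[unfolded nx] chk] obtain n ii pp bb ee t where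
      1: "linked y n ii pp bb ee" "t < n" "(i, st) = cfg ii pp ee t s q"
        "run (blk D) (map bb [0..<n]) (0, (True, q0)) o1 (int t, (s, q))"
        "(\<beta>, p1, e1, Some (p', e')) = (bb t, pp (Suc t), ee t, if t = 0 then None else Some (pp (t - 1), ee (t - 1)))"
      by blast
    then obtain u where u: "t = Suc u" by (cases t) auto
    have pe: "p' = pp u" "e' = ee u" "\<beta> = bb t" "p = pp t" "i = ii t"
      using 1(3,5) u backward(1) by (auto simp: cfg_def)
    have ii: "ii t = ii u + ee u" using 1(1,2) u by (auto simp: linked_def)
    have "blk D (map bb [0..<n] ! nat (int t)) (s, q) ((False, q'), o2, -1)"
      using backward(8) 1(2) pe by (simp add: blk_iff dir_def)
    then have "run (blk D) (map bb [0..<n]) (0, (True, q0)) (o1 @ o2) (int t - 1, (False, q'))"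
      using run_trans[OF 1(4) run_step1[where D = "blk D"], of "(False, q')" o2 "-1"] 1(2) by simp
    moreover have "(i + e, st') = cfg ii pp ee u False q'"
      using backward(2,3) pe u ii by (simp add: cfg_def)
    ultimately have "traces y n ii pp bb ee (o1 @ o2) (i + e, st')"
      using tracesI[OF 1(1), of u False] 1(2) u by simp
    then show ?thesis by blast
  qed
qed

section \<open>Coding by numbers, soundness and completeness of the guess\<close>

definition relabelling :: "('b \<times> nat) set" where
  "relabelling = {(s, to_nat l) | s l. s \<in> S \<and> l \<in> labels s}"

definition walk_code :: "(nat, nat, nat) twoway" where
  "walk_code = (\<lambda>a x r. \<exists>st st' os e. x = to_nat st \<and> r = (to_nat st', os, e) \<and> walk (from_nat a) st (st', os, e))"

lemma run_walk_code: "run walk_code y (i, to_nat st) os (j, to_nat st') \<longleftrightarrow> run walk (map from_nat y) (i, st) os (j, st')"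
  unfolding walk_code_def by (rule run_encode)

lemma finite_relabelling: "finite relabelling"
proof -
  have "relabelling = (\<Union>s\<in>S. (\<lambda>l. (s, to_nat l)) ` labels s)" by (auto simp: relabelling_def)
  then show ?thesis using fin finite_labels by simp
qed

lemma machine_walk_code: "machine walk_code (to_nat ` wstates)"
proof
  show "deterministic walk_code"
    unfolding deterministic_def
  proof (intro allI impI)
    fix a q x y assume "walk_code a q x" "walk_code a q y"
    then obtain st x1 ox ex y1 oy ey where
      "x = (to_nat x1, ox, ex)" "walk (from_nat a) st (x1, ox, ex)"
      "y = (to_nat y1, oy, ey)" "walk (from_nat a) st (y1, oy, ey)"
      unfolding walk_code_def by auto
    then show "x = y" using deterministicD[OF deterministic_walk] by blast
  qed
  show "unit_moves walk_code"
    using unit_moves_walk unfolding unit_moves_def walk_code_def by blast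
  show "walk_code a q (q', os, e) \<Longrightarrow> q' \<in> to_nat ` wstates" for a q q' os e
    unfolding walk_code_def using closed_walk by blast
qed

lemma wstart_in: "wstart \<in> wstates"
  using P0 q0 K by (simp add: wstart_def wstates_def)

text \<open>Forgetting the visit numbers turns a chain into a run of \<open>N\<close>, because all
  entries found in a cell are locally legal.\<close>

lemma linked_path:
  assumes "linked y n ii pp bb ee" "length y = length w"
    "\<And>i. i < length w \<Longrightarrow> set (y ! i) \<subseteq> local_entries (w ! i)"
  shows "path N w n (\<lambda>t. (ii t, fst (pp t))) bb"
  unfolding path_def
proof (intro allI impI)
  fix t assume "t < n"
  then have 1: "0 \<le> ii t" "ii t < int (length w)" "ii (Suc t) = ii t + ee t"
    "map_of (y ! nat (ii t)) (pp t) =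
        Some (bb t, (pp (Suc t), ee t), if t = 0 then None else Some (pp (t - 1), ee (t - 1)))"
    using assms(1,2) by (auto simp: linked_def)
  have "nat (ii t) < length w" using 1(1,2) by linarith
  from subsetD[OF assms(3)[OF this] map_of_SomeD[OF 1(4)]]
  have "N (w ! nat (ii t)) (fst (pp t)) (fst (pp (Suc t)), bb t, ee t)"
    by (auto simp: local_entries_def)
  then show "0 \<le> fst (ii t, fst (pp t)) \<and> fst (ii t, fst (pp t)) < int (length w) \<and>
    N (w ! nat (fst (ii t, fst (pp t)))) (snd (ii t, fst (pp t)))
      (snd (ii (Suc t), fst (pp (Suc t))), bb t, fst (ii (Suc t), fst (pp (Suc t))) - fst (ii t, fst (pp t)))"
    using 1 by simp
qed

lemma walk_code_sound:
  assumes "list_all2 (\<lambda>s a. (s, a) \<in> relabelling) w y"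
    "run walk_code y (0, to_nat wstart) os (int (length y), to_nat (None :: 'p wstate))"
  shows "\<exists>v i. run N w (0, P0) v (i, PF) \<and> run D v (0, q0) os (int (length v), qf)"
proof -
  let ?y = "map from_nat y :: 'p label list"
  from walk_traces[OF assms(2)[unfolded run_walk_code]] obtain n ii pp bb ee where
    1: "linked ?y n ii pp bb ee" "fst (pp n) = PF"
      "run (blk D) (map bb [0..<n]) (0, (True, q0)) os (int n, (True, qf))"
    by (auto simp: traces_def)
  have l: "length ?y = length w" using assms(1) by (simp add: list_all2_lengthD)
  have "set (?y ! i) \<subseteq> local_entries (w ! i)" if "i < length w" for i
    using list_all2_nthD[OF assms(1) that] l that by (auto simp: relabelling_def labels_def)
  from path_nrun[OF linked_path[OF 1(1) l this], of 0 n]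
  have "run N w (ii 0, fst (pp 0)) (concat (map bb [0..<n])) (ii n, fst (pp n))"
    unfolding run_def by blast
  moreover have "ii 0 = 0" "fst (pp 0) = P0" using 1(1) by (auto simp: linked_def)
  moreover have "run D (concat (map bb [0..<n])) (0, q0) os (int (length (concat (map bb [0..<n]))), qf)"
    using run_blk_concat[OF 1(3)] by (simp add: bpos_def)
  ultimately show ?thesis using 1(2) by auto
qed

text \<open>The right guess puts into each cell the entries of exactly those steps which the bounded
  run makes there.\<close>

lemma walk_code_complete:
  assumes "path N w n c b" "c 0 = (0, P0)" "c n = (i, PF)" "set w \<subseteq> S"
    "run D (concat (map b [0..<n])) (0, q0) os (int (length (concat (map b [0..<n]))), qf)"
    "\<And>x. card {t. t < n \<and> c t = x} < K"
  shows "\<exists>y. list_all2 (\<lambda>s a. (s, a) \<in> relabelling) w y \<and>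
    run walk_code y (0, to_nat wstart) os (int (length y), to_nat (None :: 'p wstate))"
proof -
  \<comment> \<open>numbering the visits to each configuration makes the run free of repetitions\<close>
  define pp :: "nat \<Rightarrow> 'p node" where "pp t = (snd (c t), card {u. u < t \<and> c u = c t})" for t
  define ii where "ii t = fst (c t)" for t
  define ee where "ee t = ii (Suc t) - ii t" for t
  define en where "en t = (pp t, b t, (pp (Suc t), ee t),
    if t = 0 then None else Some (pp (t - 1), ee (t - 1)))" for t
  have cN: "0 \<le> ii t" "ii t < int (length w)" "N (w ! nat (ii t)) (fst (pp t)) (fst (pp (Suc t)), b t, ee t)"
    if "t < n" for t
    using assms(1) that by (auto simp: path_def ii_def pp_def ee_def)
  \<comment> \<open>The end \<open>t = n\<close> is included because its node occurs in the last
    link.\<close>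
  have kK: "snd (pp t) < K" if "t \<le> n" for t
  proof -
    have "snd (pp t) \<le> card {u. u < n \<and> c u = c t}"
      unfolding pp_def snd_conv using that by (intro card_mono) auto
    then show ?thesis using assms(6)[of "c t"] by simp
  qed
  have pw: "pp t \<in> nodes" if "t \<le> n" for t
  proof -
    have "fst (pp t) \<in> W"
    proof (cases t)
      case 0
      then show ?thesis using assms(2) P0 by (simp add: pp_def)
    next
      case (Suc u)
      then show ?thesis using N[OF cN(3)[of u]] that by simp
    qed
    then show ?thesis using kK[OF that] by (cases "pp t") auto
  qed
  have el: "(pp (Suc t), ee t) \<in> links" "(pp t, ee t) \<in> links" "b t \<in> B" "fst (pp t) \<noteq> PF" if "t < n" for t
    using N[OF cN(3)[OF that]] pw[of t] pw[of "Suc t"] that by auto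
  have en_entries: "en t \<in> entries" if "t < n" for t
    using el[OF that] pw[of t] el(2)[of "t - 1"] that by (auto simp: en_def entries_def)
  then have en_local: "en t \<in> local_entries (w ! nat (ii t))" if "t < n" for t
    using cN(3)[OF that] that by (simp add: local_entries_def en_def)
  have inj: "t = u" if "pp t = pp u" "ii t = ii u" for t u
  proof -
    have c: "c t = c u" using that by (simp add: pp_def ii_def prod_eq_iff)
    have "\<not> t < u" if "c t = c u" "snd (pp t) = snd (pp u)" for t u
    proof
      assume "t < u"
      then have "{v. v < t \<and> c v = c t} \<subset> {v. v < u \<and> c v = c u}" using that(1) by auto
      then have "card {v. v < t \<and> c v = c t} < card {v. v < u \<and> c v = c u}"
        by (intro psubset_card_mono) auto
      then show False using that(2) by (simp add: pp_def)
    qed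
    from this[of t u] this[of u t] c that show ?thesis by (metis linorder_neqE_nat)
  qed
  define X where "X k = en ` {t. t < n \<and> ii t = int k}" for k
  have "\<exists>l. set l = X k \<and> distinct l" for k
    by (rule finite_distinct_list) (simp add: X_def)
  then obtain l where l: "\<And>k. set (l k) = X k" "\<And>k. distinct (l k)" by metis
  have Xl: "X k \<subseteq> local_entries (w ! k)" for k
  proof
    fix z assume "z \<in> X k"
    then obtain t where "t < n" "ii t = int k" "z = en t" unfolding X_def by blast
    then show "z \<in> local_entries (w ! k)" using en_local[of t] by simp
  qed
  define y where "y = map l [0..<length w]"
  have lab: "l k \<in> labels (w ! k)" for k
    using Xl[of k] l(1)[of k] card_mono[OF finite_local_entries Xl[of k]] distinct_card[OF l(2)[of k]]
    by (simp add: labels_def)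
  have "list_all2 (\<lambda>s a. (s, a) \<in> relabelling) w (map to_nat y)"
    unfolding list_all2_conv_all_nth
    using lab assms(4) by (auto simp: y_def relabelling_def)
  moreover have "linked y n ii pp b ee"
    unfolding linked_def
  proof (intro conjI allI impI)
    show "ii 0 = 0" "pp 0 = (P0, 0)" using assms(2) by (simp_all add: ii_def pp_def)
    fix t assume t: "t < n"
    show "0 \<le> ii t" "ii t < int (length y)" "ii (Suc t) = ii t + ee t"
      using cN[OF t] by (simp_all add: y_def ee_def)
    show "(pp t, b t, (pp (Suc t), ee t), if t = 0 then None else Some (pp (t - 1), ee (t - 1))) \<in> entries"
      using en_entries[OF t] by (simp add: en_def)
    have "y ! nat (ii t) = l (nat (ii t))" using cN[OF t] by (simp add: y_def)
    moreover have "en t \<in> set (l (nat (ii t)))" using cN[OF t] t unfolding l X_def by simp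
    \<comment> \<open>Nodes in one cell are distinct by \<open>inj\<close>, so \<open>map_of\<close>
      cannot return the entry of another step.\<close>
    moreover have "inj_on fst (set (l k))" for k
    proof (rule inj_onI)
      fix z z' assume z: "z \<in> set (l k)" "z' \<in> set (l k)" "fst z = fst z'"
      obtain t where t: "z = en t" "ii t = int k" using z(1) unfolding l X_def by blast
      obtain u where u: "z' = en u" "ii u = int k" using z(2) unfolding l X_def by blast
      have "t = u" using inj[of t u] z(3) t u by (simp add: en_def)
      then show "z = z'" using t u by simp
    qed
    then have "distinct (map fst (l k))" for k using l(2) by (simp add: distinct_map)
    ultimately show "map_of (y ! nat (ii t)) (pp t) =
        Some (b t, (pp (Suc t), ee t), if t = 0 then None else Some (pp (t - 1), ee (t - 1)))"
      by (simp add: en_def)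
  qed
  moreover have "run (blk D) (map b [0..<n]) (0, (True, q0)) os (int n, (True, qf))"
    using blk_concat_iff[of "map b [0..<n]" True q0 os True qf] assms(5) by (simp add: ent_def exi_def)
  moreover have "fst (pp n) = PF" using assms(3) by (simp add: pp_def)
  moreover have "0 \<le> ii n \<and> ii n < int (length y)"
  proof -
    have "n \<noteq> 0"
    proof
      assume "n = 0"
      then show False using assms(2,3) P0 by simp
    qed
    then obtain u where u: "n = Suc u" using not0_implies_Suc by blast
    then have "ee u = 0" using N[OF cN(3)[of u]] assms(3) by (simp add: pp_def)
    then show ?thesis using cN(1,2)[of u] u by (simp add: ee_def y_def)
  qed
  ultimately have "run walk y (0, wstart) os (int (length y), None)"
    using walk_complete by blast
  then have "run walk_code (map to_nat y) (0, to_nat wstart) os (int (length (map to_nat y)), to_nat (None :: 'p wstate))"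
    unfolding run_walk_code by (simp add: comp_def)
  then show ?thesis
    using \<open>list_all2 (\<lambda>s a. (s, a) \<in> relabelling) w (map to_nat y)\<close> by blast
qed

end

section \<open>Composition with a nondeterministic transducer\<close>

datatype wst = NI | NS nat | NF

instance wst :: countable
  by countable_datatype

text \<open>\<open>G\<close> followed by the marked relabelling \<open>R\<close>, as one machine.
  The images of the markers are written by two stationary steps with extra states: \<open>G\<close>
  may return to its initial state, and \<open>NF\<close> is thereby entered without moving.\<close>

inductive writer :: "gsm \<Rightarrow> (tsym \<times> nat) set \<Rightarrow> (tsym, wst, nat) twoway" for G R where
  start: "(LEnd, r) \<in> R \<Longrightarrow> writer G R s NI (NS (init G), [r], 0)"
| stop: "(REnd, r) \<in> R \<Longrightarrow> writer G R s (NS (final G)) (NF, [r], 0)"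
| move: "\<lbrakk>(p, \<sigma>, q1, \<alpha>1, e1, q0, \<alpha>0, e0) \<in> instrs G;
    (p', \<alpha>, e) = (if s = \<sigma> then (q1, \<alpha>1, e1) else (q0, \<alpha>0, e0));
    list_all2 (\<lambda>a r. (Sym a, r) \<in> R) \<alpha> \<beta>\<rbrakk> \<Longrightarrow> writer G R s (NS p) (NS p', \<beta>, e)"

lemma length_tape [simp]: "length (tape w) = Suc (Suc (length w))"
  by (simp add: tape_def)

lemma gsm_step_iff:
  "gsm_step M w (p, i, z) (p', i', z') \<longleftrightarrow>
    (\<exists>\<sigma> q1 \<alpha>1 e1 q0 \<alpha>0 e0 \<alpha> e. (p, \<sigma>, q1, \<alpha>1, e1, q0, \<alpha>0, e0) \<in> instrs M \<and>
      0 \<le> i \<and> i \<le> int (length w) + 1 \<and>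
      (p', \<alpha>, e) = (if tape w ! nat i = \<sigma> then (q1, \<alpha>1, e1) else (q0, \<alpha>0, e0)) \<and>
      0 \<le> i + e \<and> i + e \<le> int (length w) + 1 \<and> i' = i + e \<and> z' = z @ \<alpha>)"
  by (simp add: gsm_step_def Let_def split: prod.splits if_splits) blast

lemma marked_relabel_iff:
  "(w, y) \<in> marked_relabel R \<longleftrightarrow> list_all2 (\<lambda>s a. (s, a) \<in> R) (tape w) y"
  by (auto simp: marked_relabel_def list_all2_conv_all_nth)

lemma relabel_tape_iff:
  "list_all2 (\<lambda>s a. (s, a) \<in> R) (tape w) y \<longleftrightarrow>
    (\<exists>r \<beta> r'. y = r # \<beta> @ [r'] \<and> (LEnd, r) \<in> R \<and> (REnd, r') \<in> R \<and> list_all2 (\<lambda>a r. (Sym a, r) \<in> R) w \<beta>)"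
proof
  assume "list_all2 (\<lambda>s a. (s, a) \<in> R) (tape w) y"
  then obtain r \<beta> \<beta>' where "y = r # \<beta> @ \<beta>'" "(LEnd, r) \<in> R"
    "list_all2 (\<lambda>a r. (Sym a, r) \<in> R) w \<beta>" "list_all2 (\<lambda>s a. (s, a) \<in> R) [REnd] \<beta>'"
    by (auto simp: tape_def list_all2_Cons1 list_all2_append1 list_all2_map1)
  moreover from this(4) obtain r' where "\<beta>' = [r']" "(REnd, r') \<in> R"
    by (auto simp: list_all2_Cons1)
  ultimately show "\<exists>r \<beta> r'. y = r # \<beta> @ [r'] \<and> (LEnd, r) \<in> R \<and> (REnd, r') \<in> R \<and>
      list_all2 (\<lambda>a r. (Sym a, r) \<in> R) w \<beta>" by blast
next
  assume "\<exists>r \<beta> r'. y = r # \<beta> @ [r'] \<and> (LEnd, r) \<in> R \<and> (REnd, r') \<in> R \<and>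
      list_all2 (\<lambda>a r. (Sym a, r) \<in> R) w \<beta>"
  then show "list_all2 (\<lambda>s a. (s, a) \<in> R) (tape w) y"
    by (auto simp: tape_def list_all2_map1 intro!: list_all2_appendI)
qed

text \<open>Entering \<open>NF\<close> takes at least one step, which starts on the tape. This
  supplies the bounds that \<open>gsm_step\<close> imposes after a move.\<close>

lemma run_NF_inside:
  assumes "run (writer G R) v (k, NS p) \<beta> (j, NF)"
  shows "0 \<le> k" "k < int (length v)"
  using run_cases_inside[OF assms] by auto

lemma run_NF: "run (writer G R) v (k, NF) os c' \<Longrightarrow> os = [] \<and> c' = (k, NF)"
  by (induction "(k, NF)" os c' rule: run_induct) (auto elim: writer.cases)

lemma writer_run_gsm:
  assumes "run (writer G R) (tape w) (i, NS p) \<beta> (j, NF)"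
  shows "\<exists>\<alpha> \<beta>' r k. \<beta> = \<beta>' @ [r] \<and> (REnd, r) \<in> R \<and> list_all2 (\<lambda>a r. (Sym a, r) \<in> R) \<alpha> \<beta>' \<and>
    (gsm_step G w)\<^sup>*\<^sup>* (p, i, z) (final G, k, z @ \<alpha>)"
  using assms
proof (induction "(i, NS p)" \<beta> "(j, NF)" arbitrary: i p z rule: run_induct)
  case (step i q' o1 e o2 p)
  from step.hyps(3) show ?case
  proof cases
    case (stop r)
    then have "o2 = []" using step.hyps(4) run_NF by auto
    moreover have "(gsm_step G w)\<^sup>*\<^sup>* (p, i, z) (final G, i, z @ [])" using stop by simp
    ultimately show ?thesis using stop
      by (intro exI[of _ "[]"] exI[of _ r] exI[of _ i]) auto
  next
    case (move \<sigma> q1 \<alpha>1 e1 q0 \<alpha>0 e0 p' \<alpha>)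
    have r: "run (writer G R) (tape w) (i + e, NS p') o2 (j, NF)" using step.hyps(4) move by simp
    from step.hyps(5)[of p' "z @ \<alpha>"] move obtain \<alpha>' \<beta>' r' k where
      1: "o2 = \<beta>' @ [r']" "(REnd, r') \<in> R" "list_all2 (\<lambda>a r. (Sym a, r) \<in> R) \<alpha>' \<beta>'"
        "(gsm_step G w)\<^sup>*\<^sup>* (p', i + e, z @ \<alpha>) (final G, k, (z @ \<alpha>) @ \<alpha>')" by blast
    have "gsm_step G w (p, i, z) (p', i + e, z @ \<alpha>)"
      unfolding gsm_step_iff using move step.hyps(1,2) run_NF_inside[OF r] by (force simp: tape_def)
    then have "(gsm_step G w)\<^sup>*\<^sup>* (p, i, z) (final G, k, z @ \<alpha> @ \<alpha>')"
      using 1(4) by simp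
    then show ?thesis using 1 move
      by (intro exI[of _ "\<alpha> @ \<alpha>'"] exI[of _ "o1 @ \<beta>'"] exI[of _ r'] exI[of _ k]) (auto intro: list_all2_appendI)
  qed
qed


lemma gsm_writer_run:
  assumes "(gsm_step G w)\<^sup>*\<^sup>* (p, i, z) (p', i', z')" "0 \<le> i" "i \<le> int (length w) + 1"
  shows "\<exists>\<alpha>. z' = z @ \<alpha> \<and> 0 \<le> i' \<and> i' \<le> int (length w) + 1 \<and>
    (\<forall>\<beta>. list_all2 (\<lambda>a r. (Sym a, r) \<in> R) \<alpha> \<beta> \<longrightarrow> run (writer G R) (tape w) (i, NS p) \<beta> (i', NS p'))"
  using assms
proof (induction "(p', i', z')" arbitrary: p' i' z' rule: rtranclp_induct)
  case base
  then show ?case by auto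
next
  case (step c)
  obtain p1 i1 z1 where c: "c = (p1, i1, z1)" by (cases c)
  obtain \<alpha> where IH: "z1 = z @ \<alpha>" "0 \<le> i1" "i1 \<le> int (length w) + 1"
    "\<And>\<beta>. list_all2 (\<lambda>a r. (Sym a, r) \<in> R) \<alpha> \<beta> \<Longrightarrow> run (writer G R) (tape w) (i, NS p) \<beta> (i1, NS p1)"
    using step.hyps(3)[OF c step.prems] by blast
  from step.hyps(2)[unfolded c gsm_step_iff] obtain \<sigma> q1 \<alpha>1 e1 q0 \<alpha>0 e0 \<alpha>' e where
    1: "(p1, \<sigma>, q1, \<alpha>1, e1, q0, \<alpha>0, e0) \<in> instrs G"
      "(p', \<alpha>', e) = (if tape w ! nat i1 = \<sigma> then (q1, \<alpha>1, e1) else (q0, \<alpha>0, e0))"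
      "0 \<le> i1 + e" "i1 + e \<le> int (length w) + 1" "i' = i1 + e" "z' = z1 @ \<alpha>'" by blast
  have "run (writer G R) (tape w) (i, NS p) \<beta> (i', NS p')"
    if "list_all2 (\<lambda>a r. (Sym a, r) \<in> R) (\<alpha> @ \<alpha>') \<beta>" for \<beta>
  proof -
    from that obtain \<beta>1 \<beta>2 where \<beta>: "\<beta> = \<beta>1 @ \<beta>2" "list_all2 (\<lambda>a r. (Sym a, r) \<in> R) \<alpha> \<beta>1"
      "list_all2 (\<lambda>a r. (Sym a, r) \<in> R) \<alpha>' \<beta>2" by (auto simp: list_all2_append1)
    have "i1 < int (length (tape w))" using IH(3) by simp
    from run_step1[where D = "writer G R", OF IH(2) this move[OF 1(1,2) \<beta>(3)]]
    show ?thesis using run_trans[OF IH(4)[OF \<beta>(2)]] \<beta>(1) 1(5) by blast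
  qed
  then show ?case using IH(1) 1 by auto
qed

lemma writer_realizes:
  assumes "set w \<subseteq> inalph G"
  shows "(\<exists>i. run (writer G R) (tape w) (0, NI) y (i, NF)) \<longleftrightarrow>
    (\<exists>v. (w, v) \<in> realizes G \<and> (v, y) \<in> marked_relabel R)"
proof
  assume "\<exists>i. run (writer G R) (tape w) (0, NI) y (i, NF)"
  then obtain i where "run (writer G R) (tape w) (0, NI) y (i, NF)" ..
  then obtain q1 o1 e o2 where 1: "writer G R (tape w ! 0) NI (q1, o1, e)"
    "run (writer G R) (tape w) (0 + e, q1) o2 (i, NF)" "y = o1 @ o2"
    by (auto elim: run_cases_inside)
  from 1(1) obtain r where r: "(LEnd, r) \<in> R" "q1 = NS (init G)" "o1 = [r]" "e = 0"
    by (auto elim: writer.cases)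
  from writer_run_gsm[of G R w 0 "init G" o2 i "[]"] 1(2) r obtain \<alpha> \<beta>' r' k where
    "o2 = \<beta>' @ [r']" "(REnd, r') \<in> R" "list_all2 (\<lambda>a r. (Sym a, r) \<in> R) \<alpha> \<beta>'"
    "(gsm_step G w)\<^sup>*\<^sup>* (init G, 0, []) (final G, k, \<alpha>)" by auto
  then show "\<exists>v. (w, v) \<in> realizes G \<and> (v, y) \<in> marked_relabel R"
    using r 1(3) assms unfolding marked_relabel_iff relabel_tape_iff realizes_def by auto
next
  assume "\<exists>v. (w, v) \<in> realizes G \<and> (v, y) \<in> marked_relabel R"
  then obtain v i r \<beta> r' where v: "(gsm_step G w)\<^sup>*\<^sup>* (init G, 0, []) (final G, i, v)"
    and y: "y = [r] @ \<beta> @ [r']" "(LEnd, r) \<in> R" "(REnd, r') \<in> R" "list_all2 (\<lambda>a r. (Sym a, r) \<in> R) v \<beta>"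
    unfolding marked_relabel_iff relabel_tape_iff realizes_def by auto
  from gsm_writer_run[OF v, of R] y(4) have
    1: "0 \<le> i" "i \<le> int (length w) + 1" "run (writer G R) (tape w) (0, NS (init G)) \<beta> (i, NS (final G))"
    by auto
  have 2: "run (writer G R) (tape w) (0, NI) [r] (0, NS (init G))"
    using run_step1[where D = "writer G R" and v = "tape w", OF _ _ start[OF y(2)], of 0] by simp
  have 3: "run (writer G R) (tape w) (i, NS (final G)) [r'] (i, NF)"
    using run_step1[where D = "writer G R" and v = "tape w", OF 1(1) _ stop[OF y(3)]] 1(2) by simp
  show "\<exists>i. run (writer G R) (tape w) (0, NI) y (i, NF)"
    unfolding y(1) using run_trans[OF 2 run_trans[OF 1(3) 3]] by blast
qed

lemma realizes_outalph:
  assumes "wf_gsm G" "(w, v) \<in> realizes G"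
  shows "set v \<subseteq> outalph G"
proof -
  obtain i where "(gsm_step G w)\<^sup>*\<^sup>* (init G, 0, []) (final G, i, v)"
    using assms(2) unfolding realizes_def by blast
  then have "set (snd (snd (final G, i, v))) \<subseteq> outalph G"
  proof (induction rule: rtranclp_induct)
    case (step c c')
    obtain p i z p' i' z' where c: "c = (p, i, z)" "c' = (p', i', z')" by (metis prod_cases3)
    from step.hyps(2)[unfolded c gsm_step_iff] obtain \<sigma> q1 \<alpha>1 e1 q0 \<alpha>0 e0 \<alpha> e where
      0: "(p, \<sigma>, q1, \<alpha>1, e1, q0, \<alpha>0, e0) \<in> instrs G"
        "(p', \<alpha>, e) = (if tape w ! nat i = \<sigma> then (q1, \<alpha>1, e1) else (q0, \<alpha>0, e0))" "z' = z @ \<alpha>"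
      by blast
    then have 1: "(p, \<sigma>, q1, \<alpha>1, e1, q0, \<alpha>0, e0) \<in> instrs G" "\<alpha> = \<alpha>1 \<or> \<alpha> = \<alpha>0" "z' = z @ \<alpha>"
      by (auto split: if_splits)
    have "set \<alpha>1 \<subseteq> outalph G" "set \<alpha>0 \<subseteq> outalph G"
      using assms(1) 1(1) unfolding wf_gsm_def by fast+
    then show ?case using 1 step.IH c by auto
  qed simp
  then show ?thesis by simp
qed

text \<open>
  Acceptance here means leaving the unmarked tape to the right in state \<open>qf\<close>.
\<close>

definition accepts :: "(nat, nat, nat) twoway \<Rightarrow> nat \<Rightarrow> nat \<Rightarrow> trans" where
  "accepts D q0 qf = {(y, os). run D y (0, q0) os (int (length y), qf)}"

text \<open>The induction hypothesis. The alphabet \<open>A\<close> is a parameter because a finite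
  relabelling admits only finitely many letters, whereas \<open>Id\<close>, the empty composition,
  is defined on all strings.\<close>

definition represented :: "nat set \<Rightarrow> trans \<Rightarrow> bool" where
  "represented A m \<longleftrightarrow> (\<exists>R D Q q0 qf. finite R \<and> machine D Q \<and> finite Q \<and> q0 \<in> Q \<and>
     marked_relabel R O accepts D q0 qf \<subseteq> m \<and>
     (\<forall>w. set w \<subseteq> A \<longrightarrow> finite (m `` {w}) \<longrightarrow> m `` {w} \<subseteq> (marked_relabel R O accepts D q0 qf) `` {w}))"

lemma finite_list_all2:
  assumes "finite R"
  shows "finite {\<beta>. list_all2 (\<lambda>a r. (Sym a, r) \<in> R) \<alpha> \<beta>}"
proof (rule finite_subset)
  show "{\<beta>. list_all2 (\<lambda>a r. (Sym a, r) \<in> R) \<alpha> \<beta>} \<subseteq> {\<beta>. set \<beta> \<subseteq> snd ` R \<and> length \<beta> = length \<alpha>}"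
    by (auto simp: list_all2_conv_all_nth in_set_conv_nth) force
  show "finite {\<beta>. set \<beta> \<subseteq> snd ` R \<and> length \<beta> = length \<alpha>}"
    using finite_lists_length_eq assms by blast
qed

text \<open>\<open>R\<close> is absorbed into the writer, so that \<open>D\<close> reads what the
  writer outputs, and the walker for this pair is the new reader.\<close>

lemma represented_comp:
  assumes wf: "wf_gsm G" and rep: "represented (outalph G) m"
  shows "represented A (realizes G O m)"
proof -
  obtain R D Q q0 qf where R: "finite R" and D: "machine D Q" "finite Q" "q0 \<in> Q"
    and sub: "marked_relabel R O accepts D q0 qf \<subseteq> m"
    and sup: "\<And>w. set w \<subseteq> outalph G \<Longrightarrow> finite (m `` {w}) \<Longrightarrow>
        m `` {w} \<subseteq> (marked_relabel R O accepts D q0 qf) `` {w}"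
    using rep unfolding represented_def by blast
  interpret machine D Q by (rule D(1))
  obtain K0 where "\<forall>(N :: (tsym, wst, nat) twoway) w c0 c1 v q0 q1 os.
    q0 \<in> Q \<longrightarrow> run N w c0 v c1 \<longrightarrow> run D v (0, q0) os (int (length v), q1) \<longrightarrow>
    finite {os. \<exists>v. run N w c0 v c1 \<and> run D v (0, q0) os (int (length v), q1)} \<longrightarrow>
    (\<exists>n c b. path N w n c b \<and> c 0 = c0 \<and> c n = c1 \<and>
       run D (concat (map b [0..<n])) (0, q0) os (int (length (concat (map b [0..<n]))), q1) \<and>
       (\<forall>x. card {t. t < n \<and> c t = x} < K0))"
    by (rule exE[OF bounded_visits[OF D(2)]])
  note K0 = this[rule_format]
  define S where "S = {LEnd, REnd} \<union> Sym ` inalph G"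
  define Ws where "Ws = {NI, NF} \<union> NS ` states G"
  \<comment> \<open>All outputs of single writer steps: a string in an instruction has only finitely
    many relabelled images.\<close>
  define B where "B = (\<lambda>r. [r]) ` snd ` R \<union>
    (\<Union>(p, \<sigma>, q1, \<alpha>1, e1, q0, \<alpha>0, e0) \<in> instrs G. {\<beta>. list_all2 (\<lambda>a r. (Sym a, r) \<in> R) \<alpha>1 \<beta>} \<union>
       {\<beta>. list_all2 (\<lambda>a r. (Sym a, r) \<in> R) \<alpha>0 \<beta>})"
  have G: "init G \<in> states G" "final G \<in> states G" using wf by (auto simp: wf_gsm_def)
  have ok: "P \<in> Ws \<and> P' \<in> Ws \<and> \<beta> \<in> B \<and> e \<in> {-1, 0, 1} \<and> P \<noteq> NF \<and> (P' = NF \<longrightarrow> e = 0)"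
    if "writer G R s P (P', \<beta>, e)" for s P P' \<beta> e
    using that
  proof cases
    case (start r)
    then have "[r] \<in> B" unfolding B_def by (intro UnI1 image_eqI[of _ _ r] image_eqI[of _ _ "(LEnd, r)"]) simp_all
    then show ?thesis using start G by (simp add: Ws_def)
  next
    case (stop r)
    then have "[r] \<in> B" unfolding B_def by (intro UnI1 image_eqI[of _ _ r] image_eqI[of _ _ "(REnd, r)"]) simp_all
    then show ?thesis using stop G by (simp add: Ws_def)
  next
    case (move p \<sigma> q1 \<alpha>1 e1 q0 \<alpha>0 e0 p' \<alpha>)
    have "p \<in> states G \<and> q1 \<in> states G \<and> e1 \<in> {-1, 0, 1} \<and> q0 \<in> states G \<and> e0 \<in> {-1, 0, 1}"
      using wf move(3) unfolding wf_gsm_def by fast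
    moreover have "\<beta> \<in> B"
      unfolding B_def using move by (intro UnI2 UN_I[OF move(3)]) (auto split: if_splits)
    ultimately show ?thesis using move by (auto simp: Ws_def split: if_splits)
  qed
  \<comment> \<open>\<open>Suc\<close> makes the bound positive, so that visit number 0
    exists.\<close>
  interpret W: walker D Q "writer G R" Ws B NI NF q0 qf "Suc K0" S
  proof
    show "finite Q" by (rule D(2))
    show "finite Ws" "finite S" using wf by (auto simp: Ws_def S_def wf_gsm_def)
    show "finite B" unfolding B_def using R wf
      by (auto simp: wf_gsm_def intro!: finite_UN_I finite_list_all2)
    show "NI \<in> Ws" by (simp add: Ws_def)
    show "NI \<noteq> NF" by simp
    show "q0 \<in> Q" by (rule D(3))
    show "0 < Suc K0" by simp
    show "writer G R s P (P', \<beta>, e) \<Longrightarrow> P \<in> Ws \<and> P' \<in> Ws \<and> \<beta> \<in> B \<and> e \<in> {-1, 0, 1} \<and> P \<noteq> NF \<and> (P' = NF \<longrightarrow> e = 0)"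
      for s P P' \<beta> e by (rule ok)
  qed
  let ?R = "W.relabelling" and ?D = "accepts W.walk_code (to_nat W.wstart) (to_nat (None :: wst wstate))"
  have sound: "(w, os) \<in> realizes G O m"
    if w: "set w \<subseteq> inalph G" and rN: "run (writer G R) (tape w) (0, NI) v (i, NF)"
      and rD: "run D v (0, q0) os (int (length v), qf)" for w v i os
  proof -
    obtain u where "(w, u) \<in> realizes G" "(u, v) \<in> marked_relabel R"
      using writer_realizes[OF w] rN by blast
    moreover have "(v, os) \<in> accepts D q0 qf" using rD by (simp add: accepts_def)
    ultimately show ?thesis using sub by blast
  qed
  have "marked_relabel ?R O ?D \<subseteq> realizes G O m"
  proof
    fix x assume "x \<in> marked_relabel ?R O ?D"
    then obtain w y os where x: "x = (w, os)" "(w, y) \<in> marked_relabel ?R" "(y, os) \<in> ?D" by auto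
    then have y: "list_all2 (\<lambda>s a. (s, a) \<in> ?R) (tape w) y" by (simp add: marked_relabel_iff)
    \<comment> \<open>The writer runs on tapes over any alphabet; the input alphabet is enforced by
      the relabelling, whose domain lies in \<open>S\<close>.\<close>
    have "set w \<subseteq> inalph G"
    proof
      fix a assume "a \<in> set w"
      then have "Sym a \<in> set (tape w)" by (simp add: tape_def)
      then obtain i where "i < length (tape w)" "tape w ! i = Sym a" by (auto simp: in_set_conv_nth)
      then have "(Sym a, y ! i) \<in> ?R" using list_all2_nthD[OF y] by fastforce
      then have "Sym a \<in> S" unfolding W.relabelling_def by blast
      then show "a \<in> inalph G" by (auto simp: S_def)
    qed
    moreover have "run W.walk_code y (0, to_nat W.wstart) os (int (length y), to_nat (None :: wst wstate))"
      using x(3) by (simp add: accepts_def)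
    then obtain v i where "run (writer G R) (tape w) (0, NI) v (i, NF)"
      "run D v (0, q0) os (int (length v), qf)"
      using W.walk_code_sound[OF y] by blast
    ultimately show "x \<in> realizes G O m" using sound x(1) by blast
  qed
  moreover have "(realizes G O m) `` {w} \<subseteq> (marked_relabel ?R O ?D) `` {w}"
    if fin: "finite ((realizes G O m) `` {w})" for w
  proof
    fix os assume "os \<in> (realizes G O m) `` {w}"
    then obtain u where u: "(w, u) \<in> realizes G" "(u, os) \<in> m" by blast
    then have w: "set w \<subseteq> inalph G" by (auto simp: realizes_def)
    \<comment> \<open>Finiteness passes from the input \<open>w\<close> to the word \<open>u\<close>
      that \<open>G\<close> writes on it, since images of \<open>u\<close> are images of
      \<open>w\<close>.\<close>
    have "finite (m `` {u})" using u(1) by (intro finite_subset[OF _ fin]) blast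
    from sup[OF realizes_outalph[OF wf u(1)] this] u(2) obtain v where
      v: "(u, v) \<in> marked_relabel R" "(v, os) \<in> accepts D q0 qf" by blast
    then obtain i where i: "run (writer G R) (tape w) (0, NI) v (i, NF)"
      using writer_realizes[OF w] u(1) by blast
    have rv: "run D v (0, q0) os (int (length v), qf)" using v(2) by (simp add: accepts_def)
    have "finite {os. \<exists>v. run (writer G R) (tape w) (0, NI) v (i, NF) \<and> run D v (0, q0) os (int (length v), qf)}"
      using sound[OF w] by (intro finite_subset[OF _ fin]) blast
    from K0[OF D(3) i rv this] obtain n c b where nb: "path (writer G R) (tape w) n c b" "c 0 = (0, NI)"
      "c n = (i, NF)" "run D (concat (map b [0..<n])) (0, q0) os (int (length (concat (map b [0..<n]))), qf)"
      "\<And>x. card {t. t < n \<and> c t = x} < K0" by blast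
    have "set (tape w) \<subseteq> S" using w by (auto simp: tape_def S_def)
    from W.walk_code_complete[OF nb(1-3) this nb(4) less_SucI[OF nb(5)]] obtain y where
      "list_all2 (\<lambda>s a. (s, a) \<in> ?R) (tape w) y"
      "run W.walk_code y (0, to_nat W.wstart) os (int (length y), to_nat (None :: wst wstate))" by blast
    then show "os \<in> (marked_relabel ?R O ?D) `` {w}"
      by (auto simp: accepts_def marked_relabel_iff)
  qed
  ultimately show ?thesis
    unfolding represented_def using W.finite_relabelling W.machine_walk_code W.finite_wstates W.wstart_in
    by (intro exI[of _ ?R] exI[of _ W.walk_code] exI[of _ "to_nat ` W.wstates"] exI[of _ "to_nat W.wstart"]
        exI[of _ "to_nat (None :: wst wstate)"]) simp
qed

section \<open>The identity as base case\<close>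

text \<open>Markers are coded by 0 and a letter \<open>a\<close> by \<open>Suc a\<close>; erasing 0
  and decrementing the rest restores the input.\<close>

definition copier :: "(nat, nat, nat) twoway" where
  "copier a q r \<longleftrightarrow> q = 0 \<and> r = (0, if a = 0 then [] else [a - 1], 1)"

lemma machine_copier: "machine copier {0}"
  by unfold_locales (auto simp: copier_def deterministic_def unit_moves_def)

lemma run_copier: "run copier (u @ v) (int (length u), 0) (map (\<lambda>a. a - 1) (filter (\<lambda>a. a \<noteq> 0) v)) (int (length (u @ v)), 0)"
proof (induction v arbitrary: u)
  case (Cons a v)
  have "copier ((u @ a # v) ! nat (int (length u))) 0 (0, if a = 0 then [] else [a - 1], 1)"
    by (simp add: copier_def)
  then have "run copier (u @ a # v) (int (length u), 0) ((if a = 0 then [] else [a - 1]) @ map (\<lambda>a. a - 1) (filter (\<lambda>a. a \<noteq> 0) v))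
    (int (length (u @ a # v)), 0)"
    using Cons[of "u @ [a]"] by (intro run_step[where e = 1 and q' = 0]) (auto simp: algebra_simps)
  then show ?case by (cases "a = 0") simp_all
qed simp

lemma represented_Id:
  assumes "finite A"
  shows "represented A Id"
proof -
  let ?R = "{(LEnd, 0), (REnd, 0)} \<union> (\<lambda>a. (Sym a, Suc a)) ` A"
  have rel: "(w, y) \<in> marked_relabel ?R \<longleftrightarrow> set w \<subseteq> A \<and> y = 0 # map Suc w @ [0]" for w y
  proof -
    have "list_all2 (\<lambda>a r. (Sym a, r) \<in> ?R) w \<beta> \<longleftrightarrow> set w \<subseteq> A \<and> \<beta> = map Suc w" for \<beta>
      by (induction w arbitrary: \<beta>) (auto simp: list_all2_Cons1)
    then show ?thesis unfolding marked_relabel_iff relabel_tape_iff by auto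
  qed
  have acc: "(0 # map Suc w @ [0], os) \<in> accepts copier 0 0 \<longleftrightarrow> os = w" for w os
  proof -
    let ?y = "0 # map Suc w @ [0]"
    have "run copier ?y (0, 0) w (int (length ?y), 0)"
      using run_copier[of "[]" ?y] by (simp add: filter_map comp_def)
    moreover have "os = w" if "run copier ?y (0, 0) os (int (length ?y), 0)"
      using run_det_exit(1)[OF that _ calculation] machine.det[OF machine_copier] by simp
    ultimately show ?thesis by (auto simp: accepts_def)
  qed
  have eq: "marked_relabel ?R O accepts copier 0 0 = {(w, w) | w. set w \<subseteq> A}"
    unfolding relcomp_unfold rel using acc by auto
  have "finite ?R" using assms by simp
  then show ?thesis
    unfolding represented_def using machine_copier eq
    by (intro exI[of _ ?R] exI[of _ copier] exI[of _ "{0}"] exI[of _ 0]) auto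
qed

lemma represented_NGSM_pow:
  assumes "m \<in> fam_pow NGSM k" "finite A"
  shows "represented A m"
  using assms
proof (induction k arbitrary: m A)
  case 0
  then show ?case by (simp add: represented_Id)
next
  case (Suc k)
  then obtain G m' where G: "wf_gsm G" "m = realizes G O m'" "m' \<in> fam_pow NGSM k"
    by (auto simp: fam_comp_def NGSM_def)
  then have "represented (outalph G) m'" using Suc.IH by (simp add: wf_gsm_def)
  then show ?case using represented_comp G by blast
qed

section \<open>Implementation by a deterministic 2gsm\<close>

text \<open>\<open>CTest q as\<close> stands for state \<open>q\<close> of the reader with the
  letters \<open>as\<close> still to be tested. Instructions always have two branches, and the sink
  \<open>CStuck\<close> fills those that must fail.\<close>

datatype cstate = CInit | CTest nat "nat list" | CFinal | CStuck

instance cstate :: countable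
  by countable_datatype

locale compiler = machine D Q for D :: "(nat, nat, nat) twoway" and Q +
  fixes q0 qf :: nat and As :: "nat list"
  assumes finQ: "finite Q" and q0: "q0 \<in> Q"
begin

text \<open>
  An instruction of a deterministic 2gsm tests a single symbol, so the next symbol is found by
  testing the elements of \<open>As\<close> one after another. When all tests fail the head is at an end marker.
\<close>

definition succ :: "nat \<Rightarrow> nat \<Rightarrow> cstate \<times> nat list \<times> int" where
  "succ a q = (if \<exists>r. D a q r then case (THE r. D a q r) of (q', os, e) \<Rightarrow> (CTest q' As, os, e) else (CStuck, [], 0))"

text \<open>After all tests the reader has left its unmarked word: only \<open>qf\<close> at the
  right marker may accept, everything else blocks or goes to the sink.\<close>

fun cinstr :: "cstate \<Rightarrow> instr option" where
  "cinstr CInit = Some (to_nat CInit, LEnd, to_nat (CTest q0 As), [], 1, to_nat CStuck, [], 0)"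
| "cinstr (CTest q (a # as)) = (case succ a q of (s, os, e) \<Rightarrow>
     Some (to_nat (CTest q (a # as)), Sym a, to_nat s, os, e, to_nat (CTest q as), [], 0))"
| "cinstr (CTest q []) = (if q = qf
     then Some (to_nat (CTest q []), REnd, to_nat CFinal, [], 0, to_nat CStuck, [], 0) else None)"
| "cinstr CFinal = None"
| "cinstr CStuck = None"

definition cstates :: "cstate set" where
  "cstates = {CInit, CFinal, CStuck} \<union> (\<lambda>(q, k). CTest q (drop k As)) ` (Q \<times> {..length As})"

definition cinstrs :: "instr set" where
  "cinstrs = {i. \<exists>s\<in>cstates. cinstr s = Some i}"

definition cgsm :: gsm where
  "cgsm = \<lparr>states = to_nat ` cstates, inalph = set As,
     outalph = (\<Union>(p, \<sigma>, q1, \<alpha>1, e1, q0, \<alpha>0, e0) \<in> cinstrs. set \<alpha>1 \<union> set \<alpha>0),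
     instrs = cinstrs, init = to_nat CInit, final = to_nat CFinal\<rparr>"

lemma succ_D:
  assumes "D a q (q', os, e)"
  shows "succ a q = (CTest q' As, os, e)"
proof -
  have "(THE r. D a q r) = (q', os, e)"
    by (rule the_equality, rule assms, rule deterministicD[OF det _ assms])
  then show ?thesis using assms unfolding succ_def by auto
qed

lemma succ_cases:
  obtains q' os e where "D a q (q', os, e)" "succ a q = (CTest q' As, os, e)"
  | "succ a q = (CStuck, [], 0)"
proof (cases "\<exists>r. D a q r")
  case True
  then obtain q' os e where "D a q (q', os, e)" by auto
  then show ?thesis using that(1) succ_D by blast
next
  case False
  then show ?thesis using that(2) by (simp add: succ_def)
qed

lemma finite_cstates: "finite cstates"
  using finQ by (simp add: cstates_def)

lemma cinstrs_cases:
  assumes "i \<in> cinstrs"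
  obtains "i = (to_nat CInit, LEnd, to_nat (CTest q0 As), [], 1, to_nat CStuck, [], 0)"
  | q a as s os e where "q \<in> Q" "CTest q (a # as) \<in> cstates" "CTest q as \<in> cstates" "a \<in> set As"
      "succ a q = (s, os, e)"
      "i = (to_nat (CTest q (a # as)), Sym a, to_nat s, os, e, to_nat (CTest q as), [], 0)"
  | "CTest qf [] \<in> cstates"
      "i = (to_nat (CTest qf []), REnd, to_nat CFinal, [], 0, to_nat CStuck, [], 0)"
proof -
  from assms obtain s where s: "s \<in> cstates" "cinstr s = Some i" by (auto simp: cinstrs_def)
  then consider "s = CInit" | q k where "q \<in> Q" "k \<le> length As" "s = CTest q (drop k As)"
    by (auto simp: cstates_def)
  then show thesis
  proof cases
    case 1
    then show thesis using that(1) s by simp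
  next
    case 2
    show thesis
    proof (cases "drop k As")
      case Nil
      then show thesis using that(3) 2 s by (auto split: if_splits)
    next
      case (Cons a as)
      then have k: "Suc k \<le> length As" "as = drop (Suc k) As" "a \<in> set As"
        using 2 by (auto simp: drop_Suc tl_drop[symmetric] not_less_eq_eq intro: in_set_dropD[of a k As])
          (metis drop_all list.distinct(1) not_less_eq_eq)
      then have "CTest q as \<in> cstates" using 2 by (auto simp: cstates_def)
      moreover obtain s' os e where "succ a q = (s', os, e)" by (metis prod_cases3)
      ultimately show thesis using that(2)[of q a as s' os e] 2 s Cons k by simp
    qed
  qed
qed

lemma CTest_drop: "q \<in> Q \<Longrightarrow> k \<le> length As \<Longrightarrow> CTest q (drop k As) \<in> cstates"
  unfolding cstates_def by (intro UnI2 image_eqI[of _ _ "(q, k)"]) auto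

lemma CTest_As: "q \<in> Q \<Longrightarrow> CTest q As \<in> cstates"
  using CTest_drop[of q 0] by simp

lemma wf_cgsm: "wf_gsm cgsm"
proof -
  have "cinstrs \<subseteq> the ` cinstr ` cstates" by (force simp: cinstrs_def)
  then have fin: "finite cinstrs" using finite_cstates finite_subset by blast
  have out: "set \<alpha>1 \<subseteq> outalph cgsm \<and> set \<alpha>0 \<subseteq> outalph cgsm"
    if "(p, \<sigma>, q1, \<alpha>1, e1, r0, \<alpha>0, e0) \<in> cinstrs" for p \<sigma> q1 \<alpha>1 e1 r0 \<alpha>0 e0
    using that unfolding cgsm_def by fastforce
  have base: "CInit \<in> cstates" "CFinal \<in> cstates" "CStuck \<in> cstates" by (simp_all add: cstates_def)
  have ok: "p \<in> to_nat ` cstates \<and> p \<noteq> to_nat CFinal \<and> sym_ok (set As) \<sigma> \<and>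
        q1 \<in> to_nat ` cstates \<and> e1 \<in> {-1, 0, 1} \<and> r0 \<in> to_nat ` cstates \<and> e0 \<in> {-1, 0, 1}"
    if i: "(p, \<sigma>, q1, \<alpha>1, e1, r0, \<alpha>0, e0) \<in> cinstrs" for p \<sigma> q1 \<alpha>1 e1 r0 \<alpha>0 e0
    using i
  proof (cases rule: cinstrs_cases)
    case 1
    then show ?thesis using CTest_As[OF q0] base by (simp add: sym_ok_def)
  next
    case (2 q a as s os e)
    have "s \<in> cstates \<and> e \<in> {-1, 0, 1}"
    proof (cases rule: succ_cases[of a q])
      case (1 q' os' e')
      then have "s = CTest q' As" "D a q (q', os, e)" using 2 by auto
      then show ?thesis using CTest_As closed unit unfolding unit_moves_def by blast
    next
      case B: 2
      then show ?thesis using 2 by (simp add: cstates_def)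
    qed
    then show ?thesis using 2 by (simp add: sym_ok_def)
  next
    case 3
    then show ?thesis using base by (simp add: sym_ok_def)
  qed
  have "case i of (p, \<sigma>, q1, \<alpha>1, e1, r0, \<alpha>0, e0) \<Rightarrow>
        p \<in> states cgsm \<and> p \<noteq> final cgsm \<and> sym_ok (inalph cgsm) \<sigma> \<and>
        q1 \<in> states cgsm \<and> set \<alpha>1 \<subseteq> outalph cgsm \<and> e1 \<in> {-1, 0, 1} \<and>
        r0 \<in> states cgsm \<and> set \<alpha>0 \<subseteq> outalph cgsm \<and> e0 \<in> {-1, 0, 1}" if i: "i \<in> instrs cgsm" for i
  proof -
    obtain p \<sigma> q1 \<alpha>1 e1 r0 \<alpha>0 e0 where i': "i = (p, \<sigma>, q1, \<alpha>1, e1, r0, \<alpha>0, e0)" by (metis surj_pair)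
    then have "(p, \<sigma>, q1, \<alpha>1, e1, r0, \<alpha>0, e0) \<in> cinstrs" using i by (simp add: cgsm_def)
    from ok[OF this] out[OF this] show ?thesis unfolding i' by (simp add: cgsm_def)
  qed
  moreover have "finite (outalph cgsm)" using fin by (auto simp: cgsm_def)
  moreover have "finite (states cgsm)" "finite (inalph cgsm)" "finite (instrs cgsm)"
    "init cgsm \<in> states cgsm" "final cgsm \<in> states cgsm"
    using fin finite_cstates base by (simp_all add: cgsm_def)
  ultimately show ?thesis unfolding wf_gsm_def by blast
qed

text \<open>The source of an instruction is the code of the state it comes from; codes are injective
  and \<open>cinstr\<close> is a function.\<close>

lemma det_cgsm: "det_gsm cgsm"
proof -
  have "fst i = to_nat s" if "cinstr s = Some i" for s i
    using that by (cases s rule: cinstr.cases) (auto split: prod.splits if_splits)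
  note fst_i = this
  show ?thesis
    unfolding det_gsm_def
  proof (intro ballI impI)
    fix i j assume "i \<in> instrs cgsm" "j \<in> instrs cgsm" and eq: "fst i = fst j"
    then obtain s t where st: "cinstr s = Some i" "cinstr t = Some j"
      by (auto simp: cgsm_def cinstrs_def)
    then have "s = t" using fst_i eq by simp
    then show "i = j" using st by simp
  qed
qed

lemma tape_inner: "0 \<le> i \<Longrightarrow> i < int (length y) \<Longrightarrow> tape y ! nat (i + 1) = Sym (y ! nat i)"
  by (simp add: tape_def nat_add_distrib nth_append)

lemma tape_last: "tape y ! nat (int (length y) + 1) = REnd"
  by (simp add: tape_def nat_add_distrib nth_append)

lemma tape_SymD:
  assumes "tape y ! nat i = Sym a" "0 \<le> i" "i \<le> int (length y) + 1"
  shows "0 \<le> i - 1 \<and> i - 1 < int (length y) \<and> y ! nat (i - 1) = a"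
proof -
  have "i \<noteq> 0" using assms(1) by (auto simp: tape_def)
  moreover have "i \<noteq> int (length y) + 1" using assms(1) tape_last[of y] by auto
  ultimately have "0 \<le> i - 1" "i - 1 < int (length y)" using assms(2,3) by auto
  then show ?thesis using tape_inner[of "i - 1" y] assms(1) by simp
qed

lemma tape_REndD:
  assumes "tape y ! nat i = REnd" "0 \<le> i" "i \<le> int (length y) + 1"
  shows "i = int (length y) + 1"
proof (rule ccontr)
  assume "i \<noteq> int (length y) + 1"
  moreover have "i \<noteq> 0" using assms(1) by (auto simp: tape_def)
  ultimately have "0 \<le> i - 1" "i - 1 < int (length y)" using assms(2,3) by auto
  then show False using tape_inner[of "i - 1" y] assms(1) by simp
qed

section \<open>Correctness of the compiled machine\<close>

text \<open>Position \<open>i\<close> of the marked tape is position \<open>i - 1\<close> of the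
  word. Failed tests neither move nor write, so a \<open>CTest\<close> state describes one
  configuration of \<open>D\<close> whatever tests remain.\<close>

definition reached :: "nat list \<Rightarrow> nat \<times> int \<times> nat list \<Rightarrow> bool" where
  "reached y c \<longleftrightarrow> (case c of (p, i, z) \<Rightarrow> case from_nat p of
     CInit \<Rightarrow> i = 0 \<and> z = []
   | CTest q as \<Rightarrow> run D y (0, q0) z (i - 1, q)
   | CFinal \<Rightarrow> run D y (0, q0) z (int (length y), qf)
   | CStuck \<Rightarrow> True)"

lemma reached_step:
  assumes "reached y c" "gsm_step cgsm y c c'"
  shows "reached y c'"
proof -
  obtain p i z p' i' z' where c: "c = (p, i, z)" "c' = (p', i', z')" by (metis prod_cases3)
  from assms(2)[unfolded c gsm_step_iff] obtain \<sigma> q1 \<alpha>1 e1 r0 \<alpha>0 e0 \<alpha> e where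
    1: "(p, \<sigma>, q1, \<alpha>1, e1, r0, \<alpha>0, e0) \<in> cinstrs" "0 \<le> i" "i \<le> int (length y) + 1"
      "(p', \<alpha>, e) = (if tape y ! nat i = \<sigma> then (q1, \<alpha>1, e1) else (r0, \<alpha>0, e0))"
      "i' = i + e" "z' = z @ \<alpha>"
    unfolding cgsm_def by auto
  from 1(1) show ?thesis
  proof (cases rule: cinstrs_cases)
    case A: 1
    then show ?thesis using 1 assms(1) by (auto simp: reached_def c split: if_splits)
  next
    case (2 q a as s os e')
    have r: "run D y (0, q0) z (i - 1, q)" using assms(1) 2 by (simp add: reached_def c)
    show ?thesis
    proof (cases "tape y ! nat i = \<sigma>")
      case False
      then show ?thesis using 1 2 r by (simp add: reached_def c)
    next
      case True
      then have p': "p' = to_nat s" "\<alpha> = os" "e = e'" using 1(4) 2 by auto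
      have a: "0 \<le> i - 1" "i - 1 < int (length y)" "y ! nat (i - 1) = a"
        using tape_SymD[of y i a] True 2 1(2,3) by auto
      show ?thesis
      proof (cases rule: succ_cases[of a q])
        case (1 q' os' e1')
        then have "s = CTest q' As" "D (y ! nat (i - 1)) q (q', os, e')" using 2 a by auto
        moreover from run_trans[OF r run_step1[where D = D, OF a(1,2) this(2)]]
        have "run D y (0, q0) (z @ os) (i - 1 + e', q')" .
        ultimately show ?thesis using \<open>i' = i + e\<close> \<open>z' = z @ \<alpha>\<close> p'
          by (simp add: reached_def c diff_add_eq)
      next
        case B: 2
        then show ?thesis using p' 2 by (simp add: reached_def c)
      qed
    qed
  next
    case 3
    have r: "run D y (0, q0) z (i - 1, qf)" using assms(1) 3 by (simp add: reached_def c)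
    show ?thesis
    proof (cases "tape y ! nat i = REnd")
      case True
      then have "i = int (length y) + 1" using tape_REndD 1(2,3) by blast
      then show ?thesis using True 1 3 r by (simp add: reached_def c)
    next
      case False
      then show ?thesis using 1 3 by (simp add: reached_def c)
    qed
  qed
qed

lemma cgsm_sound:
  assumes "(y, os) \<in> realizes cgsm"
  shows "(y, os) \<in> accepts D q0 qf"
proof -
  obtain i where "(gsm_step cgsm y)\<^sup>*\<^sup>* (to_nat CInit, 0, []) (to_nat CFinal, i, os)"
    using assms by (auto simp: realizes_def cgsm_def)
  then have "reached y (to_nat CFinal, i, os)"
  proof (induction rule: rtranclp_induct)
    case base
    then show ?case by (simp add: reached_def)
  next
    case (step c c')
    then show ?case using reached_step by blast
  qed
  then show ?thesis by (simp add: reached_def accepts_def)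
qed

lemma cgsm_stepI:
  assumes "s \<in> cstates" "cinstr s = Some (to_nat s, \<sigma>, q1, \<alpha>1, e1, r0, \<alpha>0, e0)"
    "(p', \<alpha>, e) = (if tape y ! nat i = \<sigma> then (q1, \<alpha>1, e1) else (r0, \<alpha>0, e0))"
    "0 \<le> i" "i \<le> int (length y) + 1" "0 \<le> i + e" "i + e \<le> int (length y) + 1"
  shows "gsm_step cgsm y (to_nat s, i, z) (p', i + e, z @ \<alpha>)"
proof -
  have "(to_nat s, \<sigma>, q1, \<alpha>1, e1, r0, \<alpha>0, e0) \<in> instrs cgsm"
    using assms(1,2) unfolding cgsm_def cinstrs_def by auto
  then show ?thesis unfolding gsm_step_iff using assms(3-) by blast
qed

lemma CTest_skip:
  assumes "q \<in> Q" "k \<le> length As" "0 \<le> i" "i \<le> int (length y) + 1" "j \<le> k"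
    "\<And>l. j \<le> l \<Longrightarrow> l < k \<Longrightarrow> tape y ! nat i \<noteq> Sym (As ! l)"
  shows "(gsm_step cgsm y)\<^sup>*\<^sup>* (to_nat (CTest q (drop j As)), i, z) (to_nat (CTest q (drop k As)), i, z)"
  using assms(5,6)
proof (induction j rule: inc_induct)
  case (step j)
  have d: "drop j As = As ! j # drop (Suc j) As" using step.hyps assms(2) by (simp add: Cons_nth_drop_Suc)
  obtain s os e where sc: "succ (As ! j) q = (s, os, e)" by (metis prod_cases3)
  have m: "CTest q (drop j As) \<in> cstates" using assms(1,2) step.hyps by (intro CTest_drop) auto
  have "gsm_step cgsm y (to_nat (CTest q (drop j As)), i, z) (to_nat (CTest q (drop (Suc j) As)), i + 0, z @ [])"
    by (rule cgsm_stepI[OF m, where \<sigma> = "Sym (As ! j)" and ?q1.0 = "to_nat s" and ?\<alpha>1.0 = os and ?e1.0 = e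
        and ?r0.0 = "to_nat (CTest q (drop (Suc j) As))" and ?\<alpha>0.0 = "[]" and ?e0.0 = 0])
      (use d sc assms(3,4) step.prems[of j] step.hyps in simp_all)
  then show ?case using step.IH step.prems by (simp add: converse_rtranclp_into_rtranclp)
qed simp

text \<open>The bounds on \<open>fst c\<close> keep the head on the marked tape; they persist
  because a step of \<open>D\<close> starts on a letter and moves by at most one.\<close>

lemma cgsm_run:
  assumes "run D y c os c'" "set y \<subseteq> set As" "snd c \<in> Q" "c' = (int (length y), qf)" "-1 \<le> fst c" "fst c \<le> int (length y)"
  shows "(gsm_step cgsm y)\<^sup>*\<^sup>* (to_nat (CTest (snd c) As), fst c + 1, z) (to_nat CFinal, int (length y) + 1, z @ os)"
  using assms(1,3-)
proof (induction arbitrary: z rule: run_induct)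
  case (refl c)
  have "(gsm_step cgsm y)\<^sup>*\<^sup>* (to_nat (CTest qf (drop 0 As)), int (length y) + 1, z)
      (to_nat (CTest qf (drop (length As) As)), int (length y) + 1, z)"
    by (rule CTest_skip) (use refl tape_last[of y] in auto)
  moreover have m: "CTest qf [] \<in> cstates"
    using refl CTest_drop[of qf "length As"] by simp
  have "gsm_step cgsm y (to_nat (CTest qf []), int (length y) + 1, z) (to_nat CFinal, int (length y) + 1 + 0, z @ [])"
    by (rule cgsm_stepI[OF m, where \<sigma> = REnd and ?q1.0 = "to_nat CFinal" and ?\<alpha>1.0 = "[]" and ?e1.0 = 0
        and ?r0.0 = "to_nat CStuck" and ?\<alpha>0.0 = "[]" and ?e0.0 = 0]) (use tape_last[of y] in simp_all)
  ultimately show ?case using refl by (simp add: rtranclp.rtrancl_into_rtrancl)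
next
  case (step i q q' o1 e o2 c')
  have "y ! nat i \<in> set As" using step.hyps(1,2) assms(2) by (auto intro!: subsetD[OF assms(2)] nth_mem)
  \<comment> \<open>\<open>As\<close> may contain repetitions; the least index guarantees that all
    earlier tests fail.\<close>
  define k where "k = (LEAST k. k < length As \<and> As ! k = y ! nat i)"
  have k: "k < length As \<and> As ! k = y ! nat i"
    unfolding k_def by (rule LeastI_ex) (use \<open>y ! nat i \<in> set As\<close> in \<open>simp add: in_set_conv_nth\<close>)
  have t: "tape y ! nat (i + 1) = Sym (As ! k)" using tape_inner step.hyps(1,2) k by simp
  have "(gsm_step cgsm y)\<^sup>*\<^sup>* (to_nat (CTest q (drop 0 As)), i + 1, z) (to_nat (CTest q (drop k As)), i + 1, z)"
  proof (rule CTest_skip)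
    fix l assume "l < k"
    then have "\<not> (l < length As \<and> As ! l = y ! nat i)" unfolding k_def by (rule not_less_Least)
    then show "tape y ! nat (i + 1) \<noteq> Sym (As ! l)" using t k \<open>l < k\<close> by auto
  qed (use k step in auto)
  moreover
  have d: "drop k As = As ! k # drop (Suc k) As" using k Cons_nth_drop_Suc[of k As] by simp
  have m: "CTest q (drop k As) \<in> cstates" using step.prems(1) k by (intro CTest_drop) auto
  have sc: "succ (As ! k) q = (CTest q' As, o1, e)" using succ_D step.hyps(3) k by simp
  have e: "e \<in> {-1, 0, 1}" using unit step.hyps(3) unfolding unit_moves_def by blast
  have "gsm_step cgsm y (to_nat (CTest q (drop k As)), i + 1, z) (to_nat (CTest q' As), i + 1 + e, z @ o1)"
    by (rule cgsm_stepI[OF m, where \<sigma> = "Sym (As ! k)" and ?q1.0 = "to_nat (CTest q' As)" and ?\<alpha>1.0 = o1 and ?e1.0 = e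
        and ?r0.0 = "to_nat (CTest q (drop (Suc k) As))" and ?\<alpha>0.0 = "[]" and ?e0.0 = 0])
      (use d sc t e step.hyps(1,2) in auto)
  moreover have "(gsm_step cgsm y)\<^sup>*\<^sup>* (to_nat (CTest q' As), i + e + 1, z @ o1) (to_nat CFinal, int (length y) + 1, (z @ o1) @ o2)"
    using step.IH[of "z @ o1"] closed[OF step.hyps(3)] step.prems step.hyps(1,2) e by auto
  ultimately show ?case by (simp add: algebra_simps)
qed

lemma cgsm_complete:
  assumes "(y, os) \<in> accepts D q0 qf" "set y \<subseteq> set As"
  shows "(y, os) \<in> realizes cgsm"
proof -
  have "CInit \<in> cstates" by (simp add: cstates_def)
  then have "gsm_step cgsm y (to_nat CInit, 0, []) (to_nat (CTest q0 As), 0 + 1, [] @ [])"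
    by (rule cgsm_stepI[where \<sigma> = LEnd and ?q1.0 = "to_nat (CTest q0 As)" and ?\<alpha>1.0 = "[]" and ?e1.0 = 1
        and ?r0.0 = "to_nat CStuck" and ?\<alpha>0.0 = "[]" and ?e0.0 = 0]) (simp_all add: tape_def)
  moreover have "(gsm_step cgsm y)\<^sup>*\<^sup>* (to_nat (CTest q0 As), 1, []) (to_nat CFinal, int (length y) + 1, os)"
    using cgsm_run[of y "(0, q0)" os _ "[]"] assms q0 by (simp add: accepts_def)
  ultimately have "(gsm_step cgsm y)\<^sup>*\<^sup>* (to_nat CInit, 0, []) (to_nat CFinal, int (length y) + 1, os)"
    by (simp add: converse_rtranclp_into_rtranclp)
  then show ?thesis using assms(2) by (auto simp: realizes_def cgsm_def)
qed

end

text \<open>The compiled machine agrees with \<open>D\<close> on words over \<open>As\<close>, and a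
  list of the range of \<open>R\<close> covers every word that the relabelling produces.\<close>

lemma accepts_DGSM:
  assumes "finite R" "machine D Q" "finite Q" "q0 \<in> Q"
  shows "marked_relabel R O accepts D q0 qf \<in> MREL \<circ>\<^sub>F DGSM"
proof -
  have "finite (snd ` R)" using assms(1) by simp
  from finite_list[OF this] obtain As where As: "set As = snd ` R" by blast
  interpret machine D Q by (rule assms(2))
  interpret compiler D Q q0 qf As by unfold_locales (rule assms(3,4))+
  have "set y \<subseteq> set As" if "(w, y) \<in> marked_relabel R" for w y
    using that unfolding As by (force simp: marked_relabel_def in_set_conv_nth)
  then have "(y, os) \<in> accepts D q0 qf \<longleftrightarrow> (y, os) \<in> realizes cgsm" if "(w, y) \<in> marked_relabel R" for w y os
    using that cgsm_sound[of y os] cgsm_complete[of y os] by blast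
  then have eq: "marked_relabel R O accepts D q0 qf = marked_relabel R O realizes cgsm" by blast
  have "marked_relabel R \<in> MREL" using assms(1) unfolding MREL_def by blast
  moreover have "realizes cgsm \<in> DGSM" using wf_cgsm det_cgsm unfolding DGSM_def by blast
  ultimately show ?thesis unfolding eq fam_comp_def by blast
qed

theorem theorem6p9:
  fixes m :: trans and k :: nat
  assumes "k \<ge> 1" and "m \<in> fam_pow NGSM k" and "finitary m"
  shows "m \<in> MREL \<circ>\<^sub>F DGSM"
proof -
  \<comment> \<open>At least one factor is needed here: the input alphabet of the first one is a
    finite alphabet for the whole domain of \<open>m\<close>.\<close>
  obtain k' where k: "k = Suc k'" using assms(1) by (cases k) auto
  then obtain G m' where G: "wf_gsm G" "m = realizes G O m'"
    using assms(2) by (auto simp: fam_comp_def NGSM_def)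
  then have "finite (inalph G)" by (simp add: wf_gsm_def)
  from represented_NGSM_pow[OF assms(2) this] obtain R D Q q0 qf where
    1: "finite R" "machine D Q" "finite Q" "q0 \<in> Q" "marked_relabel R O accepts D q0 qf \<subseteq> m"
      "\<And>w. set w \<subseteq> inalph G \<Longrightarrow> finite (m `` {w}) \<Longrightarrow>
        m `` {w} \<subseteq> (marked_relabel R O accepts D q0 qf) `` {w}"
    unfolding represented_def by blast
  have "m \<subseteq> marked_relabel R O accepts D q0 qf"
  proof
    fix x assume x: "x \<in> m"
    obtain w z where wz: "x = (w, z)" by (cases x)
    have "set w \<subseteq> inalph G" using x G(2) wz by (auto simp: realizes_def)
    moreover have "m `` {w} = {z. (w, z) \<in> m}" by blast
    then have "finite (m `` {w})" using assms(3) x wz by (auto simp: finitary_def)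
    ultimately show "x \<in> marked_relabel R O accepts D q0 qf" using 1(6) x wz by blast
  qed
  then have "m = marked_relabel R O accepts D q0 qf" using 1(5) by blast
  then show ?thesis using accepts_DGSM[OF 1(1-4)] by simp
qed

end
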